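(* Let $\mathfrak g$ be a $5$-dimensional real Lie algebra. If there exists a coherent splitting $\mathfrak g^*=V_1\oplus V_2$ with $\dim V_1=2$ and $h^{0,3}(\mathfrak g,V_1)=0=h^{0,2}(\mathfrak g,V_1)$, then there is no hypo structure on $\mathfrak g$.
   Context: For a Lie algebra $\mathfrak g$, $d$ denotes the Chevalley--Eilenberg differential on $\Lambda^*=\Lambda^*\mathfrak g^*$, and $Z^k\subset\Lambda^k=\Lambda^k\mathfrak g^*$ is the space of closed $k$-forms. A coherent splitting of $\mathfrak g$ is a vector space decomposition $\mathfrak g^*=V_1\oplus V_2$ with $\dim V_1=r\ge 2$ such that $d(V_1)\subset\Lambda^2V_1$ and $d(V_2)\subset\Lambda^2V_1+V_1\wedge V_2$. Let $\Lambda^{p,q}$ be the image of $\Lambda^pV_1\otimes\Lambda^qV_2$ in $\Lambda^{p+q}$ (zero if $p$ or $q$ is negative). For each $k\ge0$ and $0\le p\le r$ set $$Z^k_p=Z^k\cap(\Lambda^{r,k-r}+\Lambda^{r-1,k-r+1}+\dots+\Lambda^{p,k-p}),$$ and let $H^k_p$ be the image of $Z^k_p$ in the cohomology $H^k=Z^k/d\Lambda^{k-1}$. Define $H^{p,q}(\mathfrak g,V_1)=H^{p+q}_p/H^{p+q}_{p+1}$ and $h^{p,q}(\mathfrak g,V_1)=\dim H^{p,q}(\mathfrak g,V_1)$ (these depend only on $V_1$, not on $V_2$). A hypo structure on a $5$-dimensional Lie algebra $\mathfrak g$ is a quadruplet $(\alpha,\omega_1,\omega_2,\omega_3)$, with $\alpha\in\mathfrak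 g^*$ and $\omega_i\in\Lambda^2\mathfrak g^*$, for which there is a basis $f^1,\dots,f^5$ of $\mathfrak g^*$ such that $$\alpha=f^5,\quad \omega_1=f^{12}+f^{34},\quad \omega_2=f^{13}+f^{42},\quad \omega_3=f^{14}+f^{23}\qquad (f^{ij}=f^i\wedge f^j),$$ and such that $d\omega_1=0$, $d(\omega_2\wedge\alpha)=0$ and $d(\omega_3\wedge\alpha)=0$. *)

theory Defs
  imports "HOL-Analysis.Analysis" "HOL-Library.Function_Algebras" "HOL-Library.Set_Algebras"
begin

section \<open>Real vector spaces with explicit carrier\<close>

text \<open>
  The cohomology spaces below are quotients whose denominators depend on the Lie bracket, so they
  are not types of class \<^class>\<open>real_vector\<close>. They are represented by records with a carrier; the
  elements of a quotient are cosets. Span, independence and dimension follow the definitions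
  used for the class \<^class>\<open>real_vector\<close>.
\<close>

record 'v vspace =
  vcarrier :: "'v set"
  vzero :: 'v
  vadd :: "'v \<Rightarrow> 'v \<Rightarrow> 'v"
  vscale :: "real \<Rightarrow> 'v \<Rightarrow> 'v"

definition vspace_of :: "'v::real_vector set \<Rightarrow> 'v vspace" where
  "vspace_of S = \<lparr>vcarrier = S, vzero = 0, vadd = (+), vscale = (*\<^sub>R)\<rparr>"

definition vsubspace :: "'v vspace \<Rightarrow> 'v set \<Rightarrow> bool" where
  "vsubspace V S \<longleftrightarrow> S \<subseteq> vcarrier V \<and> vzero V \<in> S \<and>
     (\<forall>x\<in>S. \<forall>y\<in>S. vadd V x y \<in> S) \<and> (\<forall>c. \<forall>x\<in>S. vscale V c x \<in> S)"

definition vspan :: "'v vspace \<Rightarrow> 'v set \<Rightarrow> 'v set" where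
  "vspan V B = vsubspace V hull B"

definition vbasis :: "'v vspace \<Rightarrow> 'v set \<Rightarrow> bool" where
  "vbasis V B \<longleftrightarrow> B \<subseteq> vcarrier V \<and> (\<forall>b\<in>B. b \<notin> vspan V (B - {b})) \<and> vspan V B = vcarrier V"

text \<open>As for \<^const>\<open>real_vector.dim\<close>, this is only meaningful in the finite-dimensional case.\<close>

definition vdim :: "'v vspace \<Rightarrow> nat" where
  "vdim V = card (SOME B. vbasis V B)"

definition vcoset :: "'v vspace \<Rightarrow> 'v set \<Rightarrow> 'v \<Rightarrow> 'v set" where
  "vcoset V W x = vadd V x ` W"

text \<open>
  The scalar multiple of a coset \<open>A\<close> is \<open>c A + W\<close> rather than \<open>c A\<close>, which would be
  the singleton of zero for \<open>c = 0\<close>.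
\<close>

definition vquotient :: "'v vspace \<Rightarrow> 'v set \<Rightarrow> 'v set vspace" where
  "vquotient V W = \<lparr>vcarrier = vcoset V W ` vcarrier V,
     vzero = W,
     vadd = (\<lambda>A B. {vadd V a b | a b. a \<in> A \<and> b \<in> B}),
     vscale = (\<lambda>c A. {vadd V (vscale V c a) w | a w. a \<in> A \<and> w \<in> W})\<rparr>"


section \<open>Exterior forms\<close>

instantiation "fun" :: (type, real_vector) real_vector
begin

definition scaleR_fun :: "real \<Rightarrow> ('a \<Rightarrow> 'b) \<Rightarrow> 'a \<Rightarrow> 'b" where
  "scaleR_fun c f = (\<lambda>x. c *\<^sub>R f x)"

instance
  by standard (simp_all add: scaleR_fun_def fun_eq_iff scaleR_add_right scaleR_add_left)

end

text \<open>
  A \<open>k\<close>-form on \<open>'g\<close> is an alternating \<open>k\<close>-linear function of the argument list, extended by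
  zero to lists of other lengths. In particular \<open>alt_forms 1\<close> is the dual space of \<open>'g\<close>.
\<close>

type_synonym 'g form = "'g list \<Rightarrow> real"

definition alt_forms :: "nat \<Rightarrow> 'g::real_vector form set" where
  "alt_forms k = {\<omega>.
     (\<forall>xs. length xs \<noteq> k \<longrightarrow> \<omega> xs = 0) \<and>
     (\<forall>xs i. length xs = k \<longrightarrow> i < k \<longrightarrow> linear (\<lambda>x. \<omega> (xs[i := x]))) \<and>
     (\<forall>xs. \<not> distinct xs \<longrightarrow> \<omega> xs = 0)}"

text \<open>
  The wedge product as a sum over shuffles: \<open>I\<close> is the set of positions of the arguments passed
  to the first factor, and the sign of the shuffle is determined by its inversions. There is no
  factorial normalisation, so for 1-forms \<open>(a \<and> b)(x, y) = a(x) b(y) - a(y) b(x)\<close>.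
\<close>

definition wedge :: "'g form \<Rightarrow> 'g form \<Rightarrow> 'g form"  (infixr \<open>\<and>\<^sub>f\<close> 75) where
  "(\<alpha> \<and>\<^sub>f \<beta>) = (\<lambda>xs. \<Sum>I \<in> Pow {..<length xs}.
     (-1) ^ card {(i, j). i \<in> I \<and> j \<notin> I \<and> j < i} * \<alpha> (nths xs I) * \<beta> (nths xs (- I)))"

definition unit_form :: "'g form" where
  "unit_form xs = (if xs = [] then 1 else 0)"

definition ext_power :: "nat \<Rightarrow> 'g::real_vector form set \<Rightarrow> 'g form set" where
  "ext_power p V = span {foldr (\<and>\<^sub>f) as unit_form | as. length as = p \<and> set as \<subseteq> V}"


section \<open>Lie algebra cohomology\<close>

locale real_lie_algebra =
  fixes br :: "'g::real_vector \<Rightarrow> 'g \<Rightarrow> 'g"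
  assumes bilinear: "bilinear br"
    and alternating: "br x x = 0"
    and jacobi: "br x (br y z) + br y (br z x) + br z (br x y) = 0"

text \<open>The Chevalley--Eilenberg differential
  \<open>d\<omega>(x\<^sub>0, \<dots>, x\<^sub>k) = \<Sum>\<^bsub>i<j\<^esub> (-1)\<^bsup>i+j\<^esup> \<omega>([x\<^sub>i, x\<^sub>j], x\<^sub>0, \<dots>, x\<^sub>k)\<close> with \<open>x\<^sub>i\<close> and \<open>x\<^sub>j\<close> omitted
  from the tail of the argument list.\<close>

definition ce_diff :: "('g \<Rightarrow> 'g \<Rightarrow> 'g) \<Rightarrow> 'g form \<Rightarrow> 'g form" where
  "ce_diff br \<omega> = (\<lambda>xs. \<Sum>(i, j) \<in> {(i, j). i < j \<and> j < length xs}.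
     (-1) ^ (i + j) * \<omega> (br (xs ! i) (xs ! j) # nths xs (- {i, j})))"

definition closed_forms :: "('g::real_vector \<Rightarrow> 'g \<Rightarrow> 'g) \<Rightarrow> nat \<Rightarrow> 'g form set" where
  "closed_forms br k = {\<omega> \<in> alt_forms k. ce_diff br \<omega> = 0}"

definition exact_forms :: "('g::real_vector \<Rightarrow> 'g \<Rightarrow> 'g) \<Rightarrow> nat \<Rightarrow> 'g form set" where
  "exact_forms br k = (if k = 0 then {0} else ce_diff br ` alt_forms (k - 1))"

definition cohomology :: "('g::real_vector \<Rightarrow> 'g \<Rightarrow> 'g) \<Rightarrow> nat \<Rightarrow> 'g form set vspace" where
  "cohomology br k = vquotient (vspace_of (closed_forms br k)) (exact_forms br k)"


section \<open>Coherent splittings\<close>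

text \<open>Sums of subspaces are the elementwise sums of sets from \<^theory>\<open>HOL-Library.Set_Algebras\<close>;
  an empty sum of subspaces is \<open>{0}\<close>.\<close>

definition bidegree :: "'g::real_vector form set \<Rightarrow> 'g form set \<Rightarrow> int \<Rightarrow> int \<Rightarrow> 'g form set" where
  "bidegree V1 V2 p q = (if p < 0 \<or> q < 0 then {0} else
     span {a \<and>\<^sub>f b | a b. a \<in> ext_power (nat p) V1 \<and> b \<in> ext_power (nat q) V2})"

definition coherent_splitting ::
    "('g::real_vector \<Rightarrow> 'g \<Rightarrow> 'g) \<Rightarrow> 'g form set \<Rightarrow> 'g form set \<Rightarrow> bool" where
  "coherent_splitting br V1 V2 \<longleftrightarrow>
     subspace V1 \<and> subspace V2 \<and> V1 + V2 = alt_forms 1 \<and> V1 \<inter> V2 = {0} \<and> dim V1 \<ge> 2 \<and>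
     ce_diff br ` V1 \<subseteq> ext_power 2 V1 \<and>
     ce_diff br ` V2 \<subseteq> ext_power 2 V1 + bidegree V1 V2 1 1"

definition filtered_closed ::
    "('g::real_vector \<Rightarrow> 'g \<Rightarrow> 'g) \<Rightarrow> 'g form set \<Rightarrow> 'g form set \<Rightarrow> nat \<Rightarrow> nat \<Rightarrow> 'g form set" where
  "filtered_closed br V1 V2 k p =
     closed_forms br k \<inter> (\<Sum>s = p..dim V1. bidegree V1 V2 (int s) (int k - int s))"

definition filtered_cohomology ::
    "('g::real_vector \<Rightarrow> 'g \<Rightarrow> 'g) \<Rightarrow> 'g form set \<Rightarrow> 'g form set \<Rightarrow> nat \<Rightarrow> nat \<Rightarrow> 'g form set set" where
  "filtered_cohomology br V1 V2 k p =
     vcoset (vspace_of (closed_forms br k)) (exact_forms br k) ` filtered_closed br V1 V2 k p"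

definition graded_cohomology ::
    "('g::real_vector \<Rightarrow> 'g \<Rightarrow> 'g) \<Rightarrow> 'g form set \<Rightarrow> 'g form set \<Rightarrow> nat \<Rightarrow> nat
      \<Rightarrow> 'g form set set vspace" where
  "graded_cohomology br V1 V2 p q =
     vquotient (cohomology br (p + q) \<lparr>vcarrier := filtered_cohomology br V1 V2 (p + q) p\<rparr>)
       (filtered_cohomology br V1 V2 (p + q) (p + 1))"

definition hodge_number ::
    "('g::real_vector \<Rightarrow> 'g \<Rightarrow> 'g) \<Rightarrow> 'g form set \<Rightarrow> 'g form set \<Rightarrow> nat \<Rightarrow> nat \<Rightarrow> nat" where
  "hodge_number br V1 V2 p q = vdim (graded_cohomology br V1 V2 p q)"


section \<open>Hypo structures\<close>

definition hypo_structure ::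
    "('g::real_vector \<Rightarrow> 'g \<Rightarrow> 'g) \<Rightarrow> 'g form \<Rightarrow> 'g form \<Rightarrow> 'g form \<Rightarrow> 'g form \<Rightarrow> bool" where
  "hypo_structure br \<alpha> \<omega>1 \<omega>2 \<omega>3 \<longleftrightarrow>
     (\<exists>f :: nat \<Rightarrow> 'g form.
        inj_on f {1..5} \<and> independent (f ` {1..5}) \<and> span (f ` {1..5}) = alt_forms 1 \<and>
        \<alpha> = f 5 \<and>
        \<omega>1 = f 1 \<and>\<^sub>f f 2 + f 3 \<and>\<^sub>f f 4 \<and>
        \<omega>2 = f 1 \<and>\<^sub>f f 3 + f 4 \<and>\<^sub>f f 2 \<and>
        \<omega>3 = f 1 \<and>\<^sub>f f 4 + f 2 \<and>\<^sub>f f 3) \<and>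
     ce_diff br \<omega>1 = 0 \<and>
     ce_diff br (\<omega>2 \<and>\<^sub>f \<alpha>) = 0 \<and>
     ce_diff br (\<omega>3 \<and>\<^sub>f \<alpha>) = 0"

end

theory Submission
  imports Defs
begin

text \<open>
  Let \<open>W\<close> be the common kernel of the 1-forms in \<open>V1\<close>, a subspace of \<open>'g\<close> of dimension 3. The
  proof restricts everything to \<open>W\<close>. Forms of bidegree \<open>(p, q)\<close> with \<open>p > 0\<close> vanish there, so
  coherence says that \<open>d\<gamma>\<close> restricts to zero for every 1-form \<open>\<gamma>\<close>; since \<open>d\<gamma>(x, y) = -\<gamma>([x, y])\<close>,
  the bracket of any two elements of \<open>W\<close> is zero (\<open>coherent_kernel_abelian\<close>), and hence all exact
  forms restrict to zero on \<open>W\<close>. If \<open>h\<^bsup>0,k\<^esup> = 0\<close>, then a closed \<open>k\<close>-form is the sum of a closed form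
  of filtration level at least 1 and an exact form, so it restricts to zero as well
  (\<open>closed_form_vanishing_on\<close>).

  Apply this to \<open>\<omega>1\<close> with \<open>k = 2\<close> and to \<open>\<omega>2 \<and> \<alpha>\<close> and \<open>\<omega>3 \<and> \<alpha>\<close> with \<open>k = 3\<close>. What remains is linear
  algebra in the coordinates \<open>f\<^sup>1, \<dots>, f\<^sup>5\<close> (\<open>no_hypo_restriction\<close>). The form \<open>\<omega>1\<close> is symplectic on
  \<open>ker \<alpha> = \<real>\<^sup>4\<close>, so it has no isotropic subspace of dimension 3 there; hence \<open>W\<close> is not inside
  \<open>ker \<alpha>\<close>, and contracting with a vector of \<open>W\<close> outside \<open>ker \<alpha>\<close> shows that \<open>\<omega>2\<close> and \<open>\<omega>3\<close> also
  vanish on the plane \<open>W \<inter> ker \<alpha>\<close>. But if \<open>u\<close> is a nonzero vector of \<open>\<real>\<^sup>4\<close>, then the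
  vectors representing the functionals \<open>\<omega>\<^sub>i(u, _)\<close> are the multiples of \<open>u\<close> by the three imaginary
  quaternion units; together with \<open>u\<close> they form an orthogonal basis. So no vector orthogonal to
  \<open>u\<close> other than 0 is annihilated by all three functionals \<open>\<omega>\<^sub>i(u, _)\<close>.

  Two points need work beyond this outline. The dimension of a record space is the cardinality of
  a chosen basis, so dimension 0 yields the trivial space only after the existence of a basis and
  the finiteness of all bases are established. And the forms of the hypo structure must be seen to
  lie in the sum of the spaces \<open>\<Lambda>\<^bsup>p,q\<^esup>\<close>, which follows by splitting each \<open>f\<^sup>i\<close> along \<open>V1 \<oplus> V2\<close>.
\<close>

section \<open>Dimension zero in record vector spaces\<close>

text \<open>
  Recovers a record space as a linear image of a subspace of an ordinary real vector space, so
  that span, independence and dimension can be transported from the type class.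
\<close>

definition linear_onto :: "'v::real_vector set \<Rightarrow> ('v \<Rightarrow> 'w) \<Rightarrow> 'w vspace \<Rightarrow> bool" where
  "linear_onto S \<pi> V \<longleftrightarrow> subspace S \<and> vcarrier V = \<pi> ` S \<and> vzero V = \<pi> 0 \<and>
     (\<forall>x\<in>S. \<forall>y\<in>S. vadd V (\<pi> x) (\<pi> y) = \<pi> (x + y)) \<and>
     (\<forall>c. \<forall>x\<in>S. vscale V c (\<pi> x) = \<pi> (c *\<^sub>R x))"

lemma vspan_image:
  assumes \<pi>: "linear_onto S \<pi> V" and "A \<subseteq> S"
  shows "vspan V (\<pi> ` A) = \<pi> ` span A"
proof
  have S: "subspace S" using \<pi> by (simp add: linear_onto_def)
  have AS: "span A \<subseteq> S" using \<open>A \<subseteq> S\<close> S by (simp add: span_minimal)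
  have "vsubspace V (\<pi> ` span A)"
    unfolding vsubspace_def
  proof (intro conjI ballI allI)
    show "\<pi> ` span A \<subseteq> vcarrier V" using \<pi> AS by (auto simp: linear_onto_def)
    have "vzero V = \<pi> 0" using \<pi> by (simp add: linear_onto_def)
    then show "vzero V \<in> \<pi> ` span A" using span_zero by blast
  next
    fix x y assume "x \<in> \<pi> ` span A" "y \<in> \<pi> ` span A"
    then obtain x' y' where *: "x = \<pi> x'" "x' \<in> span A" "y = \<pi> y'" "y' \<in> span A" by blast
    then have "vadd V x y = \<pi> (x' + y')"
      using \<pi> AS unfolding linear_onto_def by blast
    then show "vadd V x y \<in> \<pi> ` span A" using * span_add by blast
  next
    fix c x assume "x \<in> \<pi> ` span A"
    then obtain x' where *: "x = \<pi> x'" "x' \<in> span A" by blast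
    then have "vscale V c x = \<pi> (c *\<^sub>R x')"
      using \<pi> AS unfolding linear_onto_def by blast
    then show "vscale V c x \<in> \<pi> ` span A" using * span_scale by blast
  qed
  then show "vspan V (\<pi> ` A) \<subseteq> \<pi> ` span A"
    unfolding vspan_def by (intro hull_minimal image_mono span_superset)
  show "\<pi> ` span A \<subseteq> vspan V (\<pi> ` A)"
    unfolding vspan_def hull_def
  proof (rule Inter_greatest)
    fix U assume "U \<in> {t. vsubspace V t \<and> \<pi> ` A \<subseteq> t}"
    then have U: "vsubspace V U" "\<pi> ` A \<subseteq> U" by auto
    have "subspace {x \<in> S. \<pi> x \<in> U}"
    proof (rule subspaceI)
      show "0 \<in> {x \<in> S. \<pi> x \<in> U}"
        using subspace_0[OF S] U(1) \<pi> by (simp add: vsubspace_def linear_onto_def)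
    next
      fix x y assume xy: "x \<in> {x \<in> S. \<pi> x \<in> U}" "y \<in> {x \<in> S. \<pi> x \<in> U}"
      then have "\<pi> (x + y) = vadd V (\<pi> x) (\<pi> y)" using \<pi> by (simp add: linear_onto_def)
      then show "x + y \<in> {x \<in> S. \<pi> x \<in> U}"
        using xy U(1) subspace_add[OF S] by (simp add: vsubspace_def)
    next
      fix c x assume x: "x \<in> {x \<in> S. \<pi> x \<in> U}"
      then have "\<pi> (c *\<^sub>R x) = vscale V c (\<pi> x)" using \<pi> by (simp add: linear_onto_def)
      then show "c *\<^sub>R x \<in> {x \<in> S. \<pi> x \<in> U}"
        using x U(1) subspace_scale[OF S] by (simp add: vsubspace_def)
    qed
    moreover have "A \<subseteq> {x \<in> S. \<pi> x \<in> U}" using \<open>A \<subseteq> S\<close> U by auto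
    ultimately have "span A \<subseteq> {x \<in> S. \<pi> x \<in> U}" by (rule span_minimal[rotated])
    then show "\<pi> ` span A \<subseteq> U" by auto
  qed
qed

text \<open>
  Choosing a preimage for each basis element gives an independent subset of \<open>S\<close>: a relation
  between the preimages would map to one in \<open>V\<close>.
\<close>

lemma finite_vbasis:
  assumes \<pi>: "linear_onto S \<pi> V"
    and fin: "\<And>I. I \<subseteq> S \<Longrightarrow> independent I \<Longrightarrow> finite I"
    and B: "vbasis V B"
  shows "finite B"
proof -
  have "B \<subseteq> \<pi> ` S" using B \<pi> by (simp add: vbasis_def linear_onto_def)
  then have "\<forall>b\<in>B. \<exists>x\<in>S. \<pi> x = b" by blast
  then obtain g where g: "\<And>b. b \<in> B \<Longrightarrow> g b \<in> S \<and> \<pi> (g b) = b" by metis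
  have inj: "inj_on g B" using g by (metis inj_onI)
  have "independent (g ` B)"
    unfolding dependent_def
  proof clarify
    fix b assume b: "b \<in> B" "g b \<in> span (g ` B - {g b})"
    have "g ` B - {g b} = g ` (B - {b})"
      using inj b(1) by (auto simp: inj_on_def)
    then have "\<pi> (g b) \<in> \<pi> ` span (g ` (B - {b}))" using b(2) by (metis imageI)
    also have "\<dots> = vspan V (\<pi> ` g ` (B - {b}))"
      by (rule vspan_image[OF \<pi>, symmetric]) (use g in auto)
    also have "\<pi> ` g ` (B - {b}) = B - {b}" using g by (force simp: image_iff)
    finally show False using B b(1) g by (simp add: vbasis_def)
  qed
  then have "finite (g ` B)" using fin g by blast
  then show "finite B" using inj by (rule finite_imageD)
qed

text \<open>
  The image of a basis of \<open>S\<close> is a finite spanning set, and a spanning subset of least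
  cardinality is independent.
\<close>

lemma ex_vbasis:
  assumes \<pi>: "linear_onto S \<pi> V"
    and fin: "\<And>I. I \<subseteq> S \<Longrightarrow> independent I \<Longrightarrow> finite I"
  shows "\<exists>B. vbasis V B"
proof -
  have S: "subspace S" using \<pi> by (simp add: linear_onto_def)
  obtain T where T: "T \<subseteq> S" "independent T" "S \<subseteq> span T" using basis_exists by metis
  then have "finite T" using fin by blast
  have "vspan V (\<pi> ` T) = vcarrier V"
    using vspan_image[OF \<pi> T(1)] \<pi> T S by (metis linear_onto_def span_minimal subset_antisym)
  then have ex: "\<exists>C. C \<subseteq> \<pi> ` T \<and> vspan V C = vcarrier V" by blast
  define C where "C = arg_min card (\<lambda>C. C \<subseteq> \<pi> ` T \<and> vspan V C = vcarrier V)"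
  have C: "C \<subseteq> \<pi> ` T" "vspan V C = vcarrier V"
    using arg_min_natI[of "\<lambda>C. C \<subseteq> \<pi> ` T \<and> vspan V C = vcarrier V", of _ card] ex C_def by blast+
  have min: "card C \<le> card D" if "D \<subseteq> \<pi> ` T" "vspan V D = vcarrier V" for D
    unfolding C_def by (rule arg_min_nat_le) (use that in simp)
  have "finite C" using C \<open>finite T\<close> finite_subset by blast
  have "b \<notin> vspan V (C - {b})" if "b \<in> C" for b
  proof
    assume "b \<in> vspan V (C - {b})"
    then have "vspan V (C - {b}) = vspan V (insert b (C - {b}))"
      unfolding vspan_def by (rule hull_redundant[symmetric])
    then have "card C \<le> card (C - {b})"
      using min[of "C - {b}"] C that by (auto simp: insert_absorb)
    then show False using that \<open>finite C\<close> by (metis card_Diff1_less leD)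
  qed
  moreover have "C \<subseteq> vcarrier V" using C(1) image_mono[OF T(1), of \<pi>] \<pi> by (simp add: linear_onto_def)
  ultimately show ?thesis using C vbasis_def by blast
qed

lemma vdim_zero_trivial:
  assumes \<pi>: "linear_onto S \<pi> V"
    and fin: "\<And>I. I \<subseteq> S \<Longrightarrow> independent I \<Longrightarrow> finite I"
    and "vdim V = 0" and "x \<in> S"
  shows "\<pi> x = vzero V"
proof -
  define B where "B = (SOME B. vbasis V B)"
  have B: "vbasis V B" unfolding B_def using ex_vbasis[OF \<pi> fin] by (rule someI_ex)
  have "card B = 0" using \<open>vdim V = 0\<close> by (simp add: vdim_def B_def)
  then have "B = {}" using finite_vbasis[OF \<pi> fin B] by simp
  then have "vcarrier V = \<pi> ` span {}"
    using B vspan_image[OF \<pi>, of "{}"] by (simp add: vbasis_def)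
  then show ?thesis using \<pi> \<open>x \<in> S\<close> by (auto simp: linear_onto_def)
qed

lemma coset_eq: "vcoset (vspace_of Z) E z = (+) z ` E"
  by (simp add: vcoset_def vspace_of_def)

lemma coset_add:
  assumes "subspace E"
  shows "{a + b | a b. a \<in> (+) z ` E \<and> b \<in> (+) w ` E} = (+) (z + w) ` (E::'v::real_vector set)"
proof (intro set_eqI iffI)
  fix x assume "x \<in> {a + b | a b. a \<in> (+) z ` E \<and> b \<in> (+) w ` E}"
  then obtain e e' where *: "x = (z + e) + (w + e')" "e \<in> E" "e' \<in> E" by blast
  then have "x = (z + w) + (e + e')" by simp
  then show "x \<in> (+) (z + w) ` E" using * subspace_add[OF assms] by blast
next
  fix x assume "x \<in> (+) (z + w) ` E"
  then obtain e where *: "x = (z + e) + (w + 0)" "e \<in> E" by (auto simp: algebra_simps)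
  then show "x \<in> {a + b | a b. a \<in> (+) z ` E \<and> b \<in> (+) w ` E}"
    using subspace_0[OF assms] by blast
qed

lemma coset_scale:
  assumes "subspace E"
  shows "{c *\<^sub>R a + w | a w. a \<in> (+) z ` E \<and> w \<in> E} = (+) (c *\<^sub>R z) ` (E::'v::real_vector set)"
proof (intro set_eqI iffI)
  fix x assume "x \<in> {c *\<^sub>R a + w | a w. a \<in> (+) z ` E \<and> w \<in> E}"
  then obtain e e' where *: "x = c *\<^sub>R (z + e) + e'" "e \<in> E" "e' \<in> E" by blast
  then have "x = c *\<^sub>R z + (c *\<^sub>R e + e')" by (simp add: algebra_simps)
  then show "x \<in> (+) (c *\<^sub>R z) ` E"
    using * subspace_add[OF assms] subspace_scale[OF assms] by blast
next
  fix x assume "x \<in> (+) (c *\<^sub>R z) ` E"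
  then obtain e where *: "x = c *\<^sub>R (z + 0) + e" "e \<in> E" by auto
  then show "x \<in> {c *\<^sub>R a + w | a w. a \<in> (+) z ` E \<and> w \<in> E}"
    using subspace_0[OF assms] by blast
qed

lemma Collect_image_pair:
  "{F a b | a b. a \<in> f ` A \<and> b \<in> g ` B} = {F (f v) (g w) | v w. v \<in> A \<and> w \<in> B}"
  by blast

text \<open>
  The shape of the graded cohomology, a quotient of a space of cosets by another such space.
  The class of \<open>z\<close> is the family of all cosets \<open>(z + w) + E\<close> with \<open>w \<in> Z1\<close>.
\<close>

lemma subquotient_linear_onto:
  fixes E Z Z0 Z1 :: "'v::real_vector set"
  defines "coset \<equiv> vcoset (vspace_of Z) E"
  defines "V \<equiv> vquotient (vquotient (vspace_of Z) E \<lparr>vcarrier := coset ` Z0\<rparr>) (coset ` Z1)"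
  defines "\<pi> \<equiv> \<lambda>z. (\<lambda>w. coset (z + w)) ` Z1"
  assumes E: "subspace E" and Z0: "subspace Z0" and Z1: "subspace Z1"
  shows "linear_onto Z0 \<pi> V"
proof -
  let ?Q = "vquotient (vspace_of Z) E \<lparr>vcarrier := coset ` Z0\<rparr>"
  have co: "coset z = (+) z ` E" for z by (simp add: coset_def coset_eq)
  have add: "vadd ?Q (coset z) (coset w) = coset (z + w)" for z w
    using coset_add[OF E, of z w] by (simp add: vquotient_def co vspace_of_def)
  have scale: "vscale ?Q c (coset z) = coset (c *\<^sub>R z)" for c z
    using coset_scale[OF E, of c z] by (simp add: vquotient_def co vspace_of_def)
  have pi: "vcoset ?Q (coset ` Z1) (coset z) = \<pi> z" for z
    unfolding vcoset_def \<pi>_def image_image add ..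
  have V: "vadd V A B = {vadd ?Q a b | a b. a \<in> A \<and> b \<in> B}"
    "vscale V c A = {vadd ?Q (vscale ?Q c a) w | a w. a \<in> A \<and> w \<in> coset ` Z1}" for A B c
    by (simp_all only: V_def vquotient_def[of ?Q] vspace.simps)
  have vadd: "vadd V (\<pi> x) (\<pi> y) = \<pi> (x + y)" for x y
  proof -
    have "vadd V (\<pi> x) (\<pi> y) = {coset ((x + v) + (y + w)) | v w. v \<in> Z1 \<and> w \<in> Z1}"
    proof -
      have "vadd V (\<pi> x) (\<pi> y) =
          {vadd ?Q (coset (x + v)) (coset (y + w)) | v w. v \<in> Z1 \<and> w \<in> Z1}"
        unfolding V \<pi>_def by (rule Collect_image_pair)
      then show ?thesis unfolding add .
    qed
    also have "\<dots> = \<pi> (x + y)"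
    proof (intro set_eqI iffI)
      fix A assume "A \<in> {coset ((x + v) + (y + w)) | v w. v \<in> Z1 \<and> w \<in> Z1}"
      then obtain v w where *: "A = coset ((x + v) + (y + w))" "v \<in> Z1" "w \<in> Z1" by blast
      then have "A = coset ((x + y) + (v + w))" by (simp add: algebra_simps)
      then show "A \<in> \<pi> (x + y)" using * subspace_add[OF Z1] unfolding \<pi>_def by blast
    next
      fix A assume "A \<in> \<pi> (x + y)"
      then obtain v where *: "A = coset ((x + v) + (y + 0))" "v \<in> Z1"
        by (auto simp: \<pi>_def algebra_simps)
      then show "A \<in> {coset ((x + v) + (y + w)) | v w. v \<in> Z1 \<and> w \<in> Z1}"
        using subspace_0[OF Z1] by blast
    qed
    finally show ?thesis .
  qed
  have vscale: "vscale V c (\<pi> x) = \<pi> (c *\<^sub>R x)" for c x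
  proof -
    have "vscale V c (\<pi> x) = {coset (c *\<^sub>R (x + v) + w) | v w. v \<in> Z1 \<and> w \<in> Z1}"
    proof -
      have "vscale V c (\<pi> x) =
          {vadd ?Q (vscale ?Q c (coset (x + v))) (coset w) | v w. v \<in> Z1 \<and> w \<in> Z1}"
        unfolding V \<pi>_def by (rule Collect_image_pair)
      then show ?thesis unfolding scale add .
    qed
    also have "\<dots> = \<pi> (c *\<^sub>R x)"
    proof (intro set_eqI iffI)
      fix A assume "A \<in> {coset (c *\<^sub>R (x + v) + w) | v w. v \<in> Z1 \<and> w \<in> Z1}"
      then obtain v w where *: "A = coset (c *\<^sub>R (x + v) + w)" "v \<in> Z1" "w \<in> Z1" by blast
      then have "A = coset (c *\<^sub>R x + (c *\<^sub>R v + w))" by (simp add: algebra_simps)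
      then show "A \<in> \<pi> (c *\<^sub>R x)"
        using * subspace_add[OF Z1] subspace_scale[OF Z1] unfolding \<pi>_def by blast
    next
      fix A assume "A \<in> \<pi> (c *\<^sub>R x)"
      then obtain v where *: "A = coset (c *\<^sub>R (x + 0) + v)" "v \<in> Z1"
        by (auto simp: \<pi>_def)
      then show "A \<in> {coset (c *\<^sub>R (x + v) + w) | v w. v \<in> Z1 \<and> w \<in> Z1}"
        using subspace_0[OF Z1] by blast
    qed
    finally show ?thesis .
  qed
  have "vcarrier V = \<pi> ` Z0"
    by (simp add: V_def vquotient_def[of ?Q] image_image pi)
  moreover have "vzero V = \<pi> 0" by (simp add: V_def vquotient_def[of ?Q] \<pi>_def)
  ultimately show ?thesis
    using Z0 vadd vscale by (simp add: linear_onto_def)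
qed

section \<open>Finite-dimensionality of spaces of forms and vanishing of graded cohomology\<close>

lemma subspace_alt_forms: "subspace (alt_forms k)"
proof (rule subspaceI)
  show "0 \<in> alt_forms k" by (simp add: alt_forms_def linear_zero)
next
  fix \<omega> \<eta> :: "'a form" assume "\<omega> \<in> alt_forms k" "\<eta> \<in> alt_forms k"
  then show "\<omega> + \<eta> \<in> alt_forms k" by (simp add: alt_forms_def linear_compose_add)
next
  fix c and \<omega> :: "'a form" assume \<omega>: "\<omega> \<in> alt_forms k"
  have "linear (\<lambda>x. c *\<^sub>R \<omega> (xs[i := x]))" if "length xs = k" "i < k" for xs i
    using \<omega> that by (intro linear_compose_scale_right) (simp add: alt_forms_def)
  then show "c *\<^sub>R \<omega> \<in> alt_forms k" using \<omega> by (simp add: alt_forms_def scaleR_fun_def)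
qed

lemma linear_ce_diff: "linear (ce_diff br)"
  by (rule linearI)
    (auto simp: ce_diff_def fun_eq_iff scaleR_fun_def case_prod_unfold algebra_simps
       sum.distrib sum_distrib_left)

lemma subspace_closed_forms: "subspace (closed_forms br k)"
proof -
  have "closed_forms br k = alt_forms k \<inter> {\<omega>. ce_diff br \<omega> = 0}"
    by (auto simp: closed_forms_def)
  then show ?thesis
    by (simp add: subspace_inter subspace_alt_forms linear_subspace_kernel linear_ce_diff)
qed

lemma subspace_exact_forms: "subspace (exact_forms br k)"
  by (simp add: exact_forms_def linear_subspace_image linear_ce_diff subspace_alt_forms)

lemma subspace_set_plus:
  assumes "subspace S" "subspace T" shows "subspace (S + T :: 'v::real_vector set)"
proof -
  have "S + T = {x + y | x y. x \<in> S \<and> y \<in> T}" by (auto simp: set_plus_def)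
  then show ?thesis using subspace_sums[OF assms] by simp
qed

lemma subspace_sum_sets:
  assumes "\<And>s. s \<in> A \<Longrightarrow> subspace (G s)"
  shows "subspace (\<Sum>s\<in>A. G s :: 'v::real_vector set)"
  using assms by (induction A rule: infinite_finite_induct)
    (auto intro!: subspace_set_plus simp: subspace_single_0 set_zero)

lemma subspace_filtered_closed: "subspace (filtered_closed br V1 V2 k p)"
  unfolding filtered_closed_def
  by (intro subspace_inter subspace_closed_forms subspace_sum_sets)
    (auto simp: bidegree_def subspace_span)

text \<open>
  The arguments are freed from the spanning set one position at a time; each position uses
  linearity in that argument.
\<close>

lemma alt_form_zero_if_zero_on_spanning:
  assumes \<omega>: "\<omega> \<in> alt_forms k" and B: "span B = UNIV"
    and zero: "\<And>bs. length bs = k \<Longrightarrow> set bs \<subseteq> B \<Longrightarrow> \<omega> bs = 0"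
  shows "\<omega> = 0"
proof -
  have "\<omega> xs = 0" if "length xs = k" "m \<le> k" "set (drop m xs) \<subseteq> B" for m xs
    using that
  proof (induction m arbitrary: xs)
    case 0
    then show ?case using zero by simp
  next
    case (Suc m)
    have lin: "linear (\<lambda>x. \<omega> (xs[m := x]))"
      using \<omega> Suc.prems by (simp add: alt_forms_def)
    have "\<omega> (xs[m := b]) = 0" if "b \<in> B" for b
    proof (rule Suc.IH)
      have "drop m (xs[m := b]) = b # drop (Suc m) xs"
        using Suc.prems by (simp add: Cons_nth_drop_Suc[symmetric])
      then show "set (drop m (xs[m := b])) \<subseteq> B" using that Suc.prems by simp
    qed (use Suc.prems in auto)
    then have "\<omega> (xs[m := x]) = 0" for x
      using linear_eq_0_on_span[OF lin, of B x] B by simp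
    from this[of "xs ! m"] show ?case by simp
  qed
  from this[of _ k] have "\<omega> xs = 0" if "length xs = k" for xs using that by simp
  then show ?thesis using \<omega> by (auto simp: alt_forms_def fun_eq_iff)
qed

text \<open>
  A \<open>k\<close>-form is determined by its values on the finitely many lists of \<open>k\<close> basis vectors, so
  restricting to those lists embeds \<open>alt_forms k\<close> in a finite-dimensional space.
\<close>

lemma finite_independent_alt_forms:
  assumes dim: "dim (UNIV :: 'g::real_vector set) > 0"
    and I: "I \<subseteq> (alt_forms k :: 'g form set)" "independent I"
  shows "finite I"
proof -
  obtain B :: "'g set" where B: "UNIV \<subseteq> span B" "card B = dim (UNIV :: 'g set)"
    using basis_exists[of "UNIV :: 'g set"] by metis
  have "finite B" using B(2) dim by (metis card.infinite less_irrefl)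
  define L where "L = {bs. set bs \<subseteq> B \<and> length bs = k}"
  have "finite L" unfolding L_def by (rule finite_lists_length_eq[OF \<open>finite B\<close>])
  define R :: "'g form \<Rightarrow> 'g form" where "R = (\<lambda>\<omega> xs. if xs \<in> L then \<omega> xs else 0)"
  define \<delta> :: "'g list \<Rightarrow> 'g form" where "\<delta> = (\<lambda>bs xs. if xs = bs then 1 else 0)"
  have lin: "linear R"
    by (rule linearI) (auto simp: R_def fun_eq_iff scaleR_fun_def)
  have "inj_on R (alt_forms k)"
    unfolding linear_injective_on_subspace_0[OF lin subspace_alt_forms]
  proof clarify
    fix \<omega> :: "'g form" assume \<omega>: "\<omega> \<in> alt_forms k" "R \<omega> = 0"
    show "\<omega> = 0"
    proof (rule alt_form_zero_if_zero_on_spanning[OF \<omega>(1)])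
      show "span B = UNIV" using B by blast
      fix bs assume "length bs = k" "set bs \<subseteq> B"
      then show "\<omega> bs = 0" using fun_cong[OF \<omega>(2), of bs] by (simp add: R_def L_def)
    qed
  qed
  moreover have "span I \<subseteq> alt_forms k" by (rule span_minimal[OF I(1) subspace_alt_forms])
  ultimately have inj: "inj_on R (span I)" by (rule inj_on_subset)
  then have ind: "independent (R ` I)"
    using lin I(2) by (simp add: linear_independent_injective_image)
  have "R \<omega> \<in> span (\<delta> ` L)" for \<omega>
  proof -
    have "(\<Sum>bs\<in>L. \<omega> bs *\<^sub>R \<delta> bs) xs = R \<omega> xs" for xs
    proof -
      have "(\<Sum>bs\<in>L. \<omega> bs *\<^sub>R \<delta> bs) xs = (\<Sum>bs\<in>L. (\<omega> bs *\<^sub>R \<delta> bs) xs)"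
        by (induction L rule: infinite_finite_induct) auto
      also have "\<dots> = (\<Sum>bs\<in>L. if xs = bs then \<omega> bs else 0)"
        by (rule sum.cong) (auto simp: scaleR_fun_def \<delta>_def)
      also have "\<dots> = R \<omega> xs" using \<open>finite L\<close> by (simp add: R_def)
      finally show ?thesis .
    qed
    then have "R \<omega> = (\<Sum>bs\<in>L. \<omega> bs *\<^sub>R \<delta> bs)" by auto
    then show ?thesis by (simp add: span_base span_scale span_sum)
  qed
  then have "finite (R ` I)"
    using independent_span_bound[OF _ ind, of "\<delta> ` L"] \<open>finite L\<close> by blast
  moreover have "inj_on R I" using inj span_superset by (rule inj_on_subset)
  ultimately show "finite I" by (rule finite_imageD)
qed

text \<open>
  The class of \<open>z\<close> contains the coset \<open>z + E\<close> of the exact forms \<open>E\<close>. As this class is zero,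
  \<open>z + E = w + E\<close> for some \<open>w\<close> of the next filtration level.
\<close>

lemma hodge_number_zero_imp:
  fixes br :: "'g::real_vector \<Rightarrow> 'g \<Rightarrow> 'g"
  assumes "dim (UNIV :: 'g set) > 0" and h: "hodge_number br V1 V2 p q = 0"
    and z: "z \<in> filtered_closed br V1 V2 (p + q) p"
  obtains w e where "w \<in> filtered_closed br V1 V2 (p + q) (p + 1)"
    and "e \<in> exact_forms br (p + q)" and "z = w + e"
proof -
  let ?k = "p + q" and ?Z1 = "filtered_closed br V1 V2 (p + q) (p + 1)"
  define coset where "coset = vcoset (vspace_of (closed_forms br ?k)) (exact_forms br ?k)"
  have onto: "linear_onto (filtered_closed br V1 V2 ?k p) (\<lambda>z. (\<lambda>w. coset (z + w)) ` ?Z1)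
      (graded_cohomology br V1 V2 p q)"
    using subquotient_linear_onto[OF subspace_exact_forms[of br ?k]
        subspace_filtered_closed[of br V1 V2 ?k p] subspace_filtered_closed[of br V1 V2 ?k "p+1"],
        of "closed_forms br ?k"]
    by (simp add: graded_cohomology_def cohomology_def filtered_cohomology_def coset_def)
  have fin: "finite I" if "I \<subseteq> filtered_closed br V1 V2 ?k p" "independent I" for I
    by (rule finite_independent_alt_forms[OF assms(1) _ that(2), of ?k])
      (use that(1) in \<open>auto simp: filtered_closed_def closed_forms_def\<close>)
  have "(\<lambda>w. coset (z + w)) ` ?Z1 = vzero (graded_cohomology br V1 V2 p q)"
    by (rule vdim_zero_trivial[OF onto fin _ z]) (use h in \<open>simp_all add: hodge_number_def\<close>)
  also have "\<dots> = coset ` ?Z1"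
    by (simp add: graded_cohomology_def vquotient_def filtered_cohomology_def coset_def)
  finally have eq: "(\<lambda>w. coset (z + w)) ` ?Z1 = coset ` ?Z1" .
  have "coset (z + 0) \<in> (\<lambda>w. coset (z + w)) ` ?Z1"
    by (rule imageI) (rule subspace_0[OF subspace_filtered_closed])
  then have "coset z \<in> coset ` ?Z1" unfolding eq by simp
  then obtain w where w: "w \<in> ?Z1" "(+) z ` exact_forms br ?k = (+) w ` exact_forms br ?k"
    by (auto simp: coset_def coset_eq)
  have "z + 0 \<in> (+) z ` exact_forms br ?k"
    by (rule imageI) (rule subspace_0[OF subspace_exact_forms])
  then have "z \<in> (+) w ` exact_forms br ?k" unfolding w(2) by simp
  then obtain e where "e \<in> exact_forms br ?k" "z = w + e" by (rule imageE)
  then show ?thesis using w(1) that by blast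
qed

section \<open>Wedge products of 1-forms\<close>

lemma alt_forms_other_length: "\<omega> \<in> alt_forms k \<Longrightarrow> length xs \<noteq> k \<Longrightarrow> \<omega> xs = 0"
  by (simp add: alt_forms_def)

lemma alt_forms_one_linear:
  assumes "a \<in> alt_forms 1" shows "linear (\<lambda>x. a [x])"
proof -
  have "linear (\<lambda>x. a ([undefined][0 := x]))"
    using assms by (simp add: alt_forms_def del: list_update_code list_update.simps)
  then show ?thesis by simp
qed

lemma wedge_add_left: "(\<alpha> + \<beta>) \<and>\<^sub>f \<gamma> = \<alpha> \<and>\<^sub>f \<gamma> + \<beta> \<and>\<^sub>f \<gamma>"
  by (simp add: wedge_def fun_eq_iff algebra_simps sum.distrib)

lemma wedge_other_length:
  assumes "\<alpha> \<in> alt_forms p" "\<beta> \<in> alt_forms q" "length xs \<noteq> p + q"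
  shows "(\<alpha> \<and>\<^sub>f \<beta>) xs = 0"
  unfolding wedge_def
proof (rule sum.neutral, rule ballI)
  fix I
  have "length (nths xs I) + length (nths xs (- I)) = card ({i. i < length xs \<and> i \<in> I} \<union> {i. i < length xs \<and> i \<in> - I})"
    unfolding length_nths by (rule card_Un_disjoint[symmetric]) auto
  also have "{i. i < length xs \<and> i \<in> I} \<union> {i. i < length xs \<and> i \<in> - I} = {..<length xs}" by auto
  finally have "length (nths xs I) + length (nths xs (- I)) = length xs" by simp
  then have "length (nths xs I) \<noteq> p \<or> length (nths xs (- I)) \<noteq> q" using assms(3) by auto
  then show "(- 1) ^ card {(i, j). i \<in> I \<and> j \<notin> I \<and> j < i} * \<alpha> (nths xs I) * \<beta> (nths xs (- I)) = 0"
    using assms(1,2) alt_forms_other_length by auto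
qed

text \<open>
  Only the shuffle that passes every argument to the first factor contributes.
\<close>

lemma wedge_unit_right: "\<alpha> \<and>\<^sub>f unit_form = \<alpha>"
proof
  fix xs :: "'a list"
  let ?n = "length xs"
  have "(\<alpha> \<and>\<^sub>f unit_form) xs = (\<Sum>I \<in> {{..<?n}}.
     (-1) ^ card {(i, j). i \<in> I \<and> j \<notin> I \<and> j < i} * \<alpha> (nths xs I) * unit_form (nths xs (- I)))"
    unfolding wedge_def
  proof (rule sum.mono_neutral_right)
    show "\<forall>I\<in>Pow {..<?n} - {{..<?n}}.
       (-1) ^ card {(i, j). i \<in> I \<and> j \<notin> I \<and> j < i} * \<alpha> (nths xs I) * unit_form (nths xs (- I)) = 0"
    proof
      fix I assume "I \<in> Pow {..<?n} - {{..<?n}}"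
      then obtain i where "i < ?n" "i \<notin> I" by auto
      then have "xs ! i \<in> set (nths xs (- I))" by (auto simp: set_nths)
      then have "nths xs (- I) \<noteq> []" by auto
      then show "(-1) ^ card {(i, j). i \<in> I \<and> j \<notin> I \<and> j < i} * \<alpha> (nths xs I) * unit_form (nths xs (- I)) = 0"
        by (simp add: unit_form_def)
    qed
  qed auto
  also have "{(i, j). i \<in> {..<?n} \<and> j \<notin> {..<?n} \<and> j < i} = {}" by auto
  then have "card {(i, j). i \<in> {..<?n} \<and> j \<notin> {..<?n} \<and> j < i} = 0" by (simp only: card.empty)
  then have "(\<Sum>I \<in> {{..<?n}}.
     (-1) ^ card {(i, j). i \<in> I \<and> j \<notin> I \<and> j < i} * \<alpha> (nths xs I) * unit_form (nths xs (- I)))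
     = \<alpha> xs * unit_form (nths xs (- {..<?n}))"
    by (simp only: sum.insert[OF finite.emptyI] sum.empty empty_iff not_False_eq_True) simp
  also have "set (nths xs (- {..<?n})) = {}" by (auto simp: set_nths)
  then have "nths xs (- {..<?n}) = []" by simp
  moreover have "(unit_form :: 'a form) [] = 1" by (simp add: unit_form_def)
  ultimately show "(\<alpha> \<and>\<^sub>f unit_form) xs = \<alpha> xs" by simp
qed

lemma wedge_unit_left: "unit_form \<and>\<^sub>f \<alpha> = \<alpha>"
proof
  fix xs :: "'a list"
  let ?n = "length xs"
  have "(unit_form \<and>\<^sub>f \<alpha>) xs = (\<Sum>I \<in> {{}}.
     (-1) ^ card {(i, j). i \<in> I \<and> j \<notin> I \<and> j < i} * unit_form (nths xs I) * \<alpha> (nths xs (- I)))"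
    unfolding wedge_def
  proof (rule sum.mono_neutral_right)
    show "\<forall>I\<in>Pow {..<?n} - {{}}.
       (-1) ^ card {(i, j). i \<in> I \<and> j \<notin> I \<and> j < i} * unit_form (nths xs I) * \<alpha> (nths xs (- I)) = 0"
    proof
      fix I assume "I \<in> Pow {..<?n} - {{}}"
      then obtain i where "i < ?n" "i \<in> I" by auto
      then have "xs ! i \<in> set (nths xs I)" by (auto simp: set_nths)
      then have "nths xs I \<noteq> []" by auto
      then show "(-1) ^ card {(i, j). i \<in> I \<and> j \<notin> I \<and> j < i} * unit_form (nths xs I) * \<alpha> (nths xs (- I)) = 0"
        by (simp add: unit_form_def)
    qed
  qed auto
  then show "(unit_form \<and>\<^sub>f \<alpha>) xs = \<alpha> xs" by (simp add: unit_form_def nths_all)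
qed

text \<open>
  A form of the shuffle sign that the simplifier can evaluate for an explicit finite set.
\<close>

lemma card_inversions:
  assumes "finite (I :: nat set)"
  shows "card {(i, j). i \<in> I \<and> j \<notin> I \<and> j < i} = (\<Sum>i\<in>I. card ({..<i} - I))"
proof -
  have "{(i, j). i \<in> I \<and> j \<notin> I \<and> j < i} = (SIGMA i:I. {..<i} - I)" by auto
  then show ?thesis using assms by (simp add: card_SigmaI)
qed

lemma wedge_eq_sum: "(\<alpha> \<and>\<^sub>f \<beta>) xs = (\<Sum>I \<in> Pow {..<length xs}.
     (-1) ^ (\<Sum>i\<in>I. card ({..<i} - I)) * \<alpha> (nths xs I) * \<beta> (nths xs (- I)))"
  unfolding wedge_def
proof (rule sum.cong[OF refl])
  fix I assume "I \<in> Pow {..<length xs}"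
  then have "finite I" using finite_subset by auto
  then show "(- 1) ^ card {(i, j). i \<in> I \<and> j \<notin> I \<and> j < i} * \<alpha> (nths xs I) * \<beta> (nths xs (- I)) =
     (-1) ^ (\<Sum>i\<in>I. card ({..<i} - I)) * \<alpha> (nths xs I) * \<beta> (nths xs (- I))"
    by (simp only: card_inversions)
qed

lemma wedge_one_one:
  assumes "a \<in> alt_forms 1" "b \<in> alt_forms 1"
  shows "(a \<and>\<^sub>f b) [x, y] = a [x] * b [y] - a [y] * b [x]"
  using assms alt_forms_other_length[OF assms(1)] alt_forms_other_length[OF assms(2)]
  by (simp add: wedge_eq_sum lessThan_Suc Pow_insert nths_Cons insert_Diff_if insert_eq_iff)

lemma wedge_one_two:
  assumes "a \<in> alt_forms 1" "\<beta> \<in> alt_forms 2"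
  shows "(a \<and>\<^sub>f \<beta>) [x, y, z] = a [x] * \<beta> [y, z] - a [y] * \<beta> [x, z] + a [z] * \<beta> [x, y]"
  using assms alt_forms_other_length[OF assms(1)] alt_forms_other_length[OF assms(2)]
  by (simp add: wedge_eq_sum lessThan_Suc Pow_insert nths_Cons insert_Diff_if insert_eq_iff)

lemma wedge_two_one:
  assumes "\<alpha> \<in> alt_forms 2" "b \<in> alt_forms 1"
  shows "(\<alpha> \<and>\<^sub>f b) [x, y, z] = \<alpha> [x, y] * b [z] - \<alpha> [x, z] * b [y] + \<alpha> [y, z] * b [x]"
  using assms alt_forms_other_length[OF assms(1)] alt_forms_other_length[OF assms(2)]
  by (simp add: wedge_eq_sum lessThan_Suc Pow_insert nths_Cons insert_Diff_if insert_eq_iff)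

text \<open>
  The determinant of the \<open>3 \<times> 3\<close> matrix of values of \<open>a, b, c\<close> at \<open>x, y, z\<close>, expanded as it
  arises from \<open>(a \<and> b) \<and> c\<close>.
\<close>

definition det3 :: "'g form \<Rightarrow> 'g form \<Rightarrow> 'g form \<Rightarrow> 'g \<Rightarrow> 'g \<Rightarrow> 'g \<Rightarrow> real" where
  "det3 a b c x y z = (a [x] * b [y] - a [y] * b [x]) * c [z]
     - (a [x] * b [z] - a [z] * b [x]) * c [y] + (a [y] * b [z] - a [z] * b [y]) * c [x]"

lemma det3_add:
  "det3 (a + a') b c x y z = det3 a b c x y z + det3 a' b c x y z"
  "det3 a (b + b') c x y z = det3 a b c x y z + det3 a b' c x y z"
  "det3 a b (c + c') x y z = det3 a b c x y z + det3 a b c' x y z"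
  by (simp_all add: det3_def algebra_simps)

lemma det3_swap: "det3 b a c x y z = - det3 a b c x y z"
  by (simp add: det3_def algebra_simps)

lemma det3_rotate: "det3 c a b x y z = det3 a b c x y z"
  by (simp add: det3_def algebra_simps)

lemma length_2E:
  assumes "length xs = 2" obtains x y where "xs = [x, y]"
  using assms by (auto simp: numeral_2_eq_2 length_Suc_conv)

lemma length_3E:
  assumes "length xs = 3" obtains x y z where "xs = [x, y, z]"
  using assms by (auto simp: numeral_3_eq_3 length_Suc_conv)

lemma wedge_one_one_alt:
  fixes a b :: "'g::real_vector form"
  assumes a: "a \<in> alt_forms 1" and b: "b \<in> alt_forms 1"
  shows "a \<and>\<^sub>f b \<in> alt_forms 2"
  unfolding alt_forms_def
proof (intro CollectI conjI allI impI)
  note lin = linear_add[OF alt_forms_one_linear[OF a]] linear_scale[OF alt_forms_one_linear[OF a]]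
    linear_add[OF alt_forms_one_linear[OF b]] linear_scale[OF alt_forms_one_linear[OF b]]
  have other: "(a \<and>\<^sub>f b) xs = 0" if "length xs \<noteq> 2" for xs
    using wedge_other_length[OF a b] that by simp
  fix xs :: "'g list"
  { show "length xs \<noteq> 2 \<Longrightarrow> (a \<and>\<^sub>f b) xs = 0" by (rule other) }
  { fix i :: nat assume "length xs = 2" "i < 2"
    then have i: "i = 0 \<or> i = 1" by auto
    obtain x y where xs: "xs = [x, y]" using \<open>length xs = 2\<close> by (rule length_2E)
    show "linear (\<lambda>x. (a \<and>\<^sub>f b) (xs[i := x]))"
      by (rule linearI; rule disjE[OF i]) (simp_all add: xs wedge_one_one[OF a b] lin algebra_simps) }
  { assume dist: "\<not> distinct xs"
    show "(a \<and>\<^sub>f b) xs = 0"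
    proof (cases "length xs = 2")
      case True
      then obtain x y where "xs = [x, y]" by (rule length_2E)
      then show ?thesis using dist by (simp add: wedge_one_one[OF a b])
    qed (rule other) }
qed

context
  fixes a b c :: "'g::real_vector form"
  assumes a: "a \<in> alt_forms 1" and b: "b \<in> alt_forms 1" and c: "c \<in> alt_forms 1"
begin

lemma wedge_three: "((a \<and>\<^sub>f b) \<and>\<^sub>f c) [x, y, z] = det3 a b c x y z"
  by (simp add: wedge_two_one[OF wedge_one_one_alt[OF a b] c] wedge_one_one[OF a b] det3_def)

text \<open>
  Both sides are determinants. Associativity is what matches the left-nested products of a hypo
  structure with the right-nested products in \<^const>\<open>ext_power\<close>.
\<close>

lemma wedge_three_assoc: "(a \<and>\<^sub>f b) \<and>\<^sub>f c = a \<and>\<^sub>f (b \<and>\<^sub>f c)"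
proof
  fix xs
  note ab = wedge_one_one_alt[OF a b] and bc = wedge_one_one_alt[OF b c]
  show "((a \<and>\<^sub>f b) \<and>\<^sub>f c) xs = (a \<and>\<^sub>f (b \<and>\<^sub>f c)) xs"
  proof (cases "length xs = 3")
    case True
    then obtain x y z where "xs = [x, y, z]" by (rule length_3E)
    then show ?thesis
      by (simp add: wedge_three wedge_one_two[OF a bc] wedge_one_one[OF b c] det3_def algebra_simps)
  next
    case False
    then show ?thesis
      using wedge_other_length[OF ab c, of xs] wedge_other_length[OF a bc, of xs] by simp
  qed
qed

lemma wedge_three_alt: "(a \<and>\<^sub>f b) \<and>\<^sub>f c \<in> alt_forms 3"
  unfolding alt_forms_def
proof (intro CollectI conjI allI impI)
  note lin = linear_add[OF alt_forms_one_linear[OF a]] linear_scale[OF alt_forms_one_linear[OF a]]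
    linear_add[OF alt_forms_one_linear[OF b]] linear_scale[OF alt_forms_one_linear[OF b]]
    linear_add[OF alt_forms_one_linear[OF c]] linear_scale[OF alt_forms_one_linear[OF c]]
  have other: "((a \<and>\<^sub>f b) \<and>\<^sub>f c) xs = 0" if "length xs \<noteq> 3" for xs
    using wedge_other_length[OF wedge_one_one_alt[OF a b] c] that by simp
  fix xs :: "'g list"
  { show "length xs \<noteq> 3 \<Longrightarrow> ((a \<and>\<^sub>f b) \<and>\<^sub>f c) xs = 0" by (rule other) }
  { fix i :: nat assume "length xs = 3" "i < 3"
    then have i: "i = 0 \<or> i = 1 \<or> i = 2" by auto
    obtain x y z where xs: "xs = [x, y, z]" using \<open>length xs = 3\<close> by (rule length_3E)
    show "linear (\<lambda>x. ((a \<and>\<^sub>f b) \<and>\<^sub>f c) (xs[i := x]))"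
      using i by (elim disjE; intro linearI;
        simp add: xs wedge_three det3_def lin algebra_simps numeral_2_eq_2) }
  { assume dist: "\<not> distinct xs"
    show "((a \<and>\<^sub>f b) \<and>\<^sub>f c) xs = 0"
    proof (cases "length xs = 3")
      case True
      then obtain x y z where xs: "xs = [x, y, z]" by (rule length_3E)
      then have "x = y \<or> x = z \<or> y = z" using dist by auto
      then show ?thesis by (elim disjE) (simp_all add: xs wedge_three det3_def algebra_simps)
    qed (rule other) }
qed

end

section \<open>Products of 1-forms and the filtration of a splitting\<close>

lemma wedge_in_bidegree:
  assumes "\<alpha> \<in> ext_power p V1" "\<beta> \<in> ext_power q V2"
  shows "\<alpha> \<and>\<^sub>f \<beta> \<in> bidegree V1 V2 (int p) (int q)"
  using assms by (auto simp: bidegree_def intro: span_base)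

lemma ext_power_0: "unit_form \<in> ext_power 0 V"
  unfolding ext_power_def by (rule span_base) auto

lemma foldr_in_ext_power:
  "set as \<subseteq> V \<Longrightarrow> foldr (\<and>\<^sub>f) as unit_form \<in> ext_power (length as) V"
  unfolding ext_power_def by (auto intro: span_base)

lemma sum_0_2: "(\<Sum>s = 0..2. G s) = G 0 + (G 1 + G (2 :: nat))"
  for G :: "nat \<Rightarrow> 'a::comm_monoid_add"
  by (simp add: numeral_2_eq_2 sum.atLeast0_atMost_Suc add.assoc)

text \<open>
  Write \<open>f = a + b\<close> and \<open>g = a' + b'\<close> along \<open>V1 \<oplus> V2\<close> and expand; the mixed terms are brought into
  the order \<open>V1 \<and> V2\<close> at the cost of a sign.
\<close>

lemma wedge_two_in_filtration:
  assumes V: "V1 + V2 = alt_forms 1" "V1 \<subseteq> alt_forms 1" "V2 \<subseteq> alt_forms 1" and "dim V1 = 2"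
    and fg: "f \<in> alt_forms 1" "g \<in> alt_forms 1"
  shows "f \<and>\<^sub>f g \<in> (\<Sum>s = 0..dim V1. bidegree V1 V2 (int s) (int 2 - int s))"
proof -
  obtain a b where f: "f = a + b" and ab: "a \<in> V1" "b \<in> V2"
    using fg(1)[folded V(1)] by (rule set_plus_elim)
  obtain a' b' where g: "g = a' + b'" and ab': "a' \<in> V1" "b' \<in> V2"
    using fg(2)[folded V(1)] by (rule set_plus_elim)
  have "b \<and>\<^sub>f b' \<in> bidegree V1 V2 0 2"
    using wedge_in_bidegree[OF ext_power_0[of V1] foldr_in_ext_power[of "[b, b']" V2]] ab ab'
    by (simp add: wedge_unit_left wedge_unit_right)
  moreover have 11: "a \<and>\<^sub>f b' \<in> bidegree V1 V2 1 1" if "a \<in> V1" "b' \<in> V2" for a b'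
    using wedge_in_bidegree[OF foldr_in_ext_power[of "[a]" V1] foldr_in_ext_power[of "[b']" V2]] that
    by (simp add: wedge_unit_left wedge_unit_right)
  then have "a \<and>\<^sub>f b' - a' \<and>\<^sub>f b \<in> bidegree V1 V2 1 1"
    using 11[OF ab(1) ab'(2)] 11[OF ab'(1) ab(2)] by (simp add: bidegree_def span_diff)
  moreover have "a \<and>\<^sub>f a' \<in> bidegree V1 V2 2 0"
    using wedge_in_bidegree[OF foldr_in_ext_power[of "[a, a']" V1] ext_power_0[of V2]] ab ab'
    by (simp add: wedge_unit_left wedge_unit_right)
  moreover have "f \<and>\<^sub>f g = b \<and>\<^sub>f b' + ((a \<and>\<^sub>f b' - a' \<and>\<^sub>f b) + a \<and>\<^sub>f a')"
  proof
    fix xs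
    have V': "a \<in> alt_forms 1" "b \<in> alt_forms 1" "a' \<in> alt_forms 1" "b' \<in> alt_forms 1"
      using V ab ab' by auto
    show "(f \<and>\<^sub>f g) xs = (b \<and>\<^sub>f b' + ((a \<and>\<^sub>f b' - a' \<and>\<^sub>f b) + a \<and>\<^sub>f a')) xs"
    proof (cases "length xs = 2")
      case True
      then obtain x y where xs: "xs = [x, y]" by (rule length_2E)
      have "(f \<and>\<^sub>f g) xs = f [x] * g [y] - f [y] * g [x]" using fg by (simp add: xs wedge_one_one)
      then show ?thesis using V' by (simp add: xs wedge_one_one f g algebra_simps)
    next
      case False
      have "(h \<and>\<^sub>f k) xs = 0" if "h \<in> alt_forms 1" "k \<in> alt_forms 1" for h k
        using wedge_other_length[OF that] False by simp
      then show ?thesis using V' fg by simp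
    qed
  qed
  ultimately show ?thesis
    unfolding \<open>dim V1 = 2\<close> sum_0_2 by (simp add: set_plus_intro)
qed

text \<open>
  This is \<open>\<Lambda>\<^sup>3 V1 = 0\<close> for a plane \<open>V1\<close>: in a basis of \<open>V1\<close> the determinant vanishes identically.
\<close>

lemma wedge_three_in_plane:
  assumes V: "V1 \<subseteq> alt_forms 1" and "dim V1 = 2" and abc: "a \<in> V1" "b \<in> V1" "c \<in> V1"
  shows "det3 a b c x y z = 0"
proof -
  obtain B where B: "B \<subseteq> V1" "V1 \<subseteq> span B" "card B = 2"
    using basis_exists[of V1] \<open>dim V1 = 2\<close> by metis
  then obtain v w where "B = {v, w}" by (auto simp: card_2_iff)
  have coord: "\<exists>k l. e = k *\<^sub>R v + l *\<^sub>R w" if "e \<in> V1" for e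
  proof -
    have "e \<in> span {v, w}" using that B \<open>B = {v, w}\<close> by blast
    then obtain k where "e - k *\<^sub>R v \<in> span {w}" using span_breakdown_eq[of e v "{w}"] by blast
    then obtain l where "e - k *\<^sub>R v = l *\<^sub>R w" by (auto simp: span_singleton)
    then have "e = k *\<^sub>R v + l *\<^sub>R w" by (simp add: algebra_simps)
    then show ?thesis by blast
  qed
  obtain k l where "a = k *\<^sub>R v + l *\<^sub>R w" using coord abc by blast
  moreover obtain k' l' where "b = k' *\<^sub>R v + l' *\<^sub>R w" using coord abc by blast
  moreover obtain k'' l'' where "c = k'' *\<^sub>R v + l'' *\<^sub>R w" using coord abc by blast
  ultimately show ?thesis by (simp add: det3_def scaleR_fun_def algebra_simps)
qed

text \<open>
  As for two factors, with one new point: the summand \<open>a \<and> a' \<and> a''\<close> has bidegree \<open>(3, 0)\<close>, which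
  the filtration does not contain, and it is zero because \<open>V1\<close> is a plane.
\<close>

lemma wedge_three_in_filtration:
  assumes V: "V1 + V2 = alt_forms 1" "V1 \<subseteq> alt_forms 1" "V2 \<subseteq> alt_forms 1" and "dim V1 = 2"
    and fgh: "f \<in> alt_forms 1" "g \<in> alt_forms 1" "h \<in> alt_forms 1"
  shows "(f \<and>\<^sub>f g) \<and>\<^sub>f h \<in> (\<Sum>s = 0..dim V1. bidegree V1 V2 (int s) (int 3 - int s))"
proof -
  obtain a b where f: "f = a + b" and ab: "a \<in> V1" "b \<in> V2"
    using fgh(1)[folded V(1)] by (rule set_plus_elim)
  obtain a' b' where g: "g = a' + b'" and ab': "a' \<in> V1" "b' \<in> V2"
    using fgh(2)[folded V(1)] by (rule set_plus_elim)
  obtain a'' b'' where h: "h = a'' + b''" and ab'': "a'' \<in> V1" "b'' \<in> V2"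
    using fgh(3)[folded V(1)] by (rule set_plus_elim)
  have V': "a \<in> alt_forms 1" "b \<in> alt_forms 1" "a' \<in> alt_forms 1" "b' \<in> alt_forms 1"
      "a'' \<in> alt_forms 1" "b'' \<in> alt_forms 1"
    using V ab ab' ab'' by auto
  have "b \<and>\<^sub>f b' \<and>\<^sub>f b'' \<in> bidegree V1 V2 0 3"
    using wedge_in_bidegree[OF ext_power_0[of V1] foldr_in_ext_power[of "[b, b', b'']" V2]] ab ab' ab''
    by (simp add: wedge_unit_left wedge_unit_right)
  then have 03: "(b \<and>\<^sub>f b') \<and>\<^sub>f b'' \<in> bidegree V1 V2 0 3" using V' by (simp add: wedge_three_assoc)
  have 12: "(u \<and>\<^sub>f v) \<and>\<^sub>f w \<in> bidegree V1 V2 1 2" if "u \<in> V1" "v \<in> V2" "w \<in> V2" for u v w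
  proof -
    have "u \<and>\<^sub>f v \<and>\<^sub>f w \<in> bidegree V1 V2 1 2"
      using wedge_in_bidegree[OF foldr_in_ext_power[of "[u]" V1] foldr_in_ext_power[of "[v, w]" V2]] that
      by (simp add: wedge_unit_left wedge_unit_right)
    moreover have "u \<in> alt_forms 1" "v \<in> alt_forms 1" "w \<in> alt_forms 1" using V that by auto
    ultimately show ?thesis by (simp add: wedge_three_assoc)
  qed
  have 21: "(u \<and>\<^sub>f v) \<and>\<^sub>f w \<in> bidegree V1 V2 2 1" if "u \<in> V1" "v \<in> V1" "w \<in> V2" for u v w
    using wedge_in_bidegree[OF foldr_in_ext_power[of "[u, v]" V1] foldr_in_ext_power[of "[w]" V2]] that
    by (simp add: wedge_unit_left wedge_unit_right)
  let ?A = "(a \<and>\<^sub>f b') \<and>\<^sub>f b'' - (a' \<and>\<^sub>f b) \<and>\<^sub>f b'' + (a'' \<and>\<^sub>f b) \<and>\<^sub>f b'"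
  let ?B = "(a \<and>\<^sub>f a') \<and>\<^sub>f b'' - (a \<and>\<^sub>f a'') \<and>\<^sub>f b' + (a' \<and>\<^sub>f a'') \<and>\<^sub>f b"
  have "?A \<in> bidegree V1 V2 1 2"
    using 12[OF ab(1) ab'(2) ab''(2)] 12[OF ab'(1) ab(2) ab''(2)] 12[OF ab''(1) ab(2) ab'(2)]
    by (simp add: bidegree_def span_diff span_add)
  moreover have "?B \<in> bidegree V1 V2 2 1"
    using 21[OF ab(1) ab'(1) ab''(2)] 21[OF ab(1) ab''(1) ab'(2)] 21[OF ab'(1) ab''(1) ab(2)]
    by (simp add: bidegree_def span_diff span_add)
  moreover have "(f \<and>\<^sub>f g) \<and>\<^sub>f h = (b \<and>\<^sub>f b') \<and>\<^sub>f b'' + (?A + ?B)"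
  proof
    fix xs
    show "((f \<and>\<^sub>f g) \<and>\<^sub>f h) xs = ((b \<and>\<^sub>f b') \<and>\<^sub>f b'' + (?A + ?B)) xs"
    proof (cases "length xs = 3")
      case True
      then obtain x y z where xs: "xs = [x, y, z]" by (rule length_3E)
      have "((f \<and>\<^sub>f g) \<and>\<^sub>f h) xs = det3 (a + b) (a' + b') (a'' + b'') x y z"
        unfolding xs wedge_three[OF fgh] unfolding f g h ..
      also have "\<dots> = det3 a a' a'' x y z + ((b \<and>\<^sub>f b') \<and>\<^sub>f b'' + (?A + ?B)) xs"
        using V' det3_swap[of b a' b'' x y z] det3_rotate[of a'' b b' x y z]
          det3_rotate[of b a' a'' x y z]
          det3_swap[of b' a a'' x y z] det3_rotate[of b' a a'' x y z]
        by (simp add: xs wedge_three det3_add)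
      finally have "((f \<and>\<^sub>f g) \<and>\<^sub>f h) xs =
        det3 a a' a'' x y z + ((b \<and>\<^sub>f b') \<and>\<^sub>f b'' + (?A + ?B)) xs" .
      then show ?thesis
        using wedge_three_in_plane[OF V(2) \<open>dim V1 = 2\<close> ab(1) ab'(1) ab''(1)] by simp
    next
      case False
      have "((u \<and>\<^sub>f v) \<and>\<^sub>f w) xs = 0" if "u \<in> alt_forms 1" "v \<in> alt_forms 1" "w \<in> alt_forms 1" for u v w
        using wedge_three_alt[OF that] False by (simp add: alt_forms_other_length)
      then show ?thesis using V' fgh by simp
    qed
  qed
  ultimately show ?thesis
    unfolding \<open>dim V1 = 2\<close> sum_0_2 using 03 by (simp add: set_plus_intro)
qed

section \<open>Restriction to the common kernel\<close>

text \<open>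
  Argument lists of all lengths are allowed, which makes this set an ideal for the wedge
  product.
\<close>

definition vanishing_on :: "'g set \<Rightarrow> 'g form set" where
  "vanishing_on W = {\<omega>. \<forall>xs. set xs \<subseteq> W \<longrightarrow> \<omega> xs = 0}"

lemma subspace_vanishing_on: "subspace (vanishing_on W)"
  by (simp add: subspace_def vanishing_on_def scaleR_fun_def)

text \<open>
  In every summand the first factor receives a sublist of the arguments.
\<close>

lemma wedge_vanishing_on:
  assumes "\<alpha> \<in> vanishing_on W" shows "\<alpha> \<and>\<^sub>f \<beta> \<in> vanishing_on W"
  unfolding vanishing_on_def
proof (intro CollectI allI impI)
  fix xs assume "set xs \<subseteq> W"
  then have "\<alpha> (nths xs I) = 0" for I
    using assms set_nths_subset[of xs I] by (simp add: vanishing_on_def)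
  then show "(\<alpha> \<and>\<^sub>f \<beta>) xs = 0" by (simp add: wedge_def)
qed

lemma ext_power_vanishing_on:
  assumes "V \<subseteq> vanishing_on W" "p > 0"
  shows "ext_power p V \<subseteq> vanishing_on W"
  unfolding ext_power_def
proof (rule span_minimal[OF _ subspace_vanishing_on], clarify)
  fix as assume "p = length as" "set as \<subseteq> V"
  then show "foldr (\<and>\<^sub>f) as unit_form \<in> vanishing_on W"
    using assms by (cases as) (auto intro: wedge_vanishing_on)
qed

lemma bidegree_vanishing_on:
  assumes "V1 \<subseteq> vanishing_on W" "p > 0"
  shows "bidegree V1 V2 p q \<subseteq> vanishing_on W"
proof (cases "q < 0")
  case True
  then show ?thesis using subspace_0[OF subspace_vanishing_on] by (auto simp: bidegree_def)
next
  case False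
  have "ext_power (nat p) V1 \<subseteq> vanishing_on W"
    using assms by (intro ext_power_vanishing_on) simp_all
  then have "{a \<and>\<^sub>f b | a b. a \<in> ext_power (nat p) V1 \<and> b \<in> ext_power (nat q) V2} \<subseteq> vanishing_on W"
    using wedge_vanishing_on by blast
  then show ?thesis
    using False assms(2) span_minimal[OF _ subspace_vanishing_on] by (simp add: bidegree_def)
qed

lemma sum_sets_subset:
  assumes "subspace K" "\<And>s. s \<in> A \<Longrightarrow> G s \<subseteq> K"
  shows "(\<Sum>s\<in>A. G s) \<subseteq> (K :: 'v::real_vector set)"
  using assms(2)
proof (induction A rule: infinite_finite_induct)
  case (insert s A)
  then have "G s \<subseteq> K" "sum G A \<subseteq> K" by simp_all
  then have "G s + sum G A \<subseteq> K"
    by (auto elim!: set_plus_elim intro!: subspace_add[OF assms(1)])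
  then show ?case using insert by simp
qed (use subspace_0[OF assms(1)] in auto)

lemma filtered_closed_vanishing_on:
  assumes "V1 \<subseteq> vanishing_on W" "p > 0"
  shows "filtered_closed br V1 V2 k p \<subseteq> vanishing_on W"
proof -
  have "(\<Sum>s = p..dim V1. bidegree V1 V2 (int s) (int k - int s)) \<subseteq> vanishing_on W"
    by (intro sum_sets_subset subspace_vanishing_on bidegree_vanishing_on)
      (use assms in auto)
  then show ?thesis by (auto simp: filtered_closed_def)
qed

text \<open>
  A nonzero vector is part of a basis, and the linear map with value 1 on it is a 1-form.
\<close>

lemma one_forms_separate_points:
  assumes "\<And>\<gamma>. \<gamma> \<in> alt_forms 1 \<Longrightarrow> \<gamma> [x] = 0"
  shows "x = (0 :: 'g::real_vector)"
proof (rule ccontr)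
  assume "x \<noteq> 0"
  then have "independent {x}" by simp
  then obtain g :: "'g \<Rightarrow> real" where g: "linear g" "g x = 1"
    using linear_independent_extend[of "{x}" "\<lambda>_. 1 :: real"] by auto
  define \<gamma> :: "'g form" where "\<gamma> = (\<lambda>xs. if length xs = 1 then g (hd xs) else 0)"
  have "\<gamma> \<in> alt_forms 1"
    unfolding alt_forms_def
  proof (intro CollectI conjI allI impI)
    fix xs :: "'g list" and i :: nat assume *: "length xs = 1" "i < 1"
    then obtain y where "xs = [y]" by (auto simp: length_Suc_conv)
    then show "linear (\<lambda>x. \<gamma> (xs[i := x]))" using * g(1) by (simp add: \<gamma>_def)
  next
    fix xs :: "'g list" assume "\<not> distinct xs"
    then have "length xs \<noteq> 1" by (auto simp: length_Suc_conv)
    then show "\<gamma> xs = 0" by (simp add: \<gamma>_def)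
  qed (simp add: \<gamma>_def)
  then show False using assms[of \<gamma>] g(2) by (simp add: \<gamma>_def)
qed

lemma ce_diff_one_form: "ce_diff br \<gamma> [x, y] = - \<gamma> [br x y]"
proof -
  have "{(i, j). i < j \<and> j < length [x, y]} = {(0, 1)}" by auto
  then show ?thesis by (simp add: ce_diff_def nths_Cons)
qed

lemma alt_form_zero_head:
  assumes "\<omega> \<in> alt_forms k" shows "\<omega> (0 # ys) = 0"
proof (cases "length (0 # ys) = k")
  case True
  then have "linear (\<lambda>x. \<omega> ((0 # ys)[0 := x]))" using assms unfolding alt_forms_def by blast
  from linear_0[OF this] show ?thesis by simp
qed (use assms in \<open>auto simp: alt_forms_def\<close>)

text \<open>
  Every term of the differential has a bracket of two arguments as its first entry.
\<close>

lemma exact_forms_vanishing_on: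
  assumes "\<And>x y. x \<in> W \<Longrightarrow> y \<in> W \<Longrightarrow> br x y = 0"
  shows "exact_forms br k \<subseteq> vanishing_on W"
proof -
  have "ce_diff br \<omega> xs = 0" if "\<omega> \<in> alt_forms l" "set xs \<subseteq> W" for \<omega> xs l
    unfolding ce_diff_def
  proof (rule sum.neutral, clarify)
    fix i j assume "i < j" "j < length xs"
    then have "br (xs ! i) (xs ! j) = 0" using that(2) by (intro assms) auto
    then show "(- 1) ^ (i + j) * \<omega> (br (xs ! i) (xs ! j) # nths xs (- {i, j})) = 0"
      using alt_form_zero_head[OF that(1)] by simp
  qed
  then show ?thesis by (auto simp: exact_forms_def vanishing_on_def)
qed

text \<open>
  By coherence the differential of every 1-form \<open>\<gamma>\<close> lies in the ideal generated by \<open>V1\<close>, so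
  \<open>\<gamma>([x, y]) = -d\<gamma>(x, y) = 0\<close>.
\<close>

lemma coherent_kernel_abelian:
  assumes V: "coherent_splitting br V1 V2" and "V1 \<subseteq> vanishing_on W" and xy: "x \<in> W" "y \<in> W"
  shows "br x y = 0"
proof (rule one_forms_separate_points)
  have E: "ext_power 2 V1 \<subseteq> vanishing_on W"
    using assms(2) by (rule ext_power_vanishing_on) simp
  have "bidegree V1 V2 1 1 \<subseteq> vanishing_on W"
    using assms(2) by (rule bidegree_vanishing_on) simp
  then have EB: "ext_power 2 V1 + bidegree V1 V2 1 1 \<subseteq> vanishing_on W"
    using E by (auto elim!: set_plus_elim intro!: subspace_add[OF subspace_vanishing_on])
  fix \<gamma> :: "'a form" assume "\<gamma> \<in> alt_forms 1"
  then have "\<gamma> \<in> V1 + V2" using V by (simp add: coherent_splitting_def)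
  then obtain a b where ab: "a \<in> V1" "b \<in> V2" "\<gamma> = a + b" by (auto simp: set_plus_def)
  have "ce_diff br a \<in> vanishing_on W" using V ab(1) E by (auto simp: coherent_splitting_def)
  moreover have "ce_diff br b \<in> vanishing_on W"
    using V ab(2) EB unfolding coherent_splitting_def by blast
  ultimately have "ce_diff br \<gamma> \<in> vanishing_on W"
    unfolding ab(3) linear_add[OF linear_ce_diff]
    by (rule subspace_add[OF subspace_vanishing_on])
  then have "ce_diff br \<gamma> [x, y] = 0" using xy by (simp add: vanishing_on_def)
  then show "\<gamma> [br x y] = 0" by (simp add: ce_diff_one_form)
qed

text \<open>
  Both parts of \<open>\<omega> = w + e\<close> vanish on \<open>W\<close>: the form \<open>w\<close> lies in filtration level 1, hence in the
  ideal generated by \<open>V1\<close>, and \<open>e\<close> is exact.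
\<close>

lemma closed_form_vanishing_on:
  fixes br :: "'g::real_vector \<Rightarrow> 'g \<Rightarrow> 'g"
  assumes dim: "dim (UNIV :: 'g set) > 0" and V: "coherent_splitting br V1 V2"
    and W: "V1 \<subseteq> vanishing_on W"
    and h: "hodge_number br V1 V2 0 k = 0"
    and \<omega>: "\<omega> \<in> closed_forms br k"
      "\<omega> \<in> (\<Sum>s = 0..dim V1. bidegree V1 V2 (int s) (int k - int s))"
  shows "\<omega> \<in> vanishing_on W"
proof -
  have "\<omega> \<in> filtered_closed br V1 V2 (0 + k) 0"
    using \<omega> by (simp add: filtered_closed_def)
  then obtain w e where w: "w \<in> filtered_closed br V1 V2 (0 + k) (0 + 1)"
    and e: "e \<in> exact_forms br (0 + k)" and "\<omega> = w + e"
    by (rule hodge_number_zero_imp[OF dim h])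
  have "w \<in> vanishing_on W"
    using w filtered_closed_vanishing_on[OF W, of "0 + 1"] by auto
  moreover have "exact_forms br (0 + k) \<subseteq> vanishing_on W"
    using coherent_kernel_abelian[OF V W] by (rule exact_forms_vanishing_on)
  then have "e \<in> vanishing_on W" using e ..
  ultimately show ?thesis
    unfolding \<open>\<omega> = w + e\<close> by (rule subspace_add[OF subspace_vanishing_on])
qed

section \<open>Linear algebra of the self-dual triple\<close>

text \<open>
  Used to choose vectors one after the other by linear conditions that are fewer than the
  dimension.
\<close>

lemma ex_common_zero:
  fixes F :: "'g::real_vector \<Rightarrow> 'b::euclidean_space"
  assumes "linear F" "DIM('b) < dim (UNIV :: 'g set)"
  shows "\<exists>x. x \<noteq> 0 \<and> F x = 0"
proof (rule ccontr)
  assume "\<nexists>x. x \<noteq> 0 \<and> F x = 0"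
  then have "inj F" using assms(1) by (auto simp: linear_injective_0)
  obtain B :: "'g set" where B: "independent B" "card B = dim (UNIV :: 'g set)"
    using basis_exists[of "UNIV :: 'g set"] by metis
  have "independent (F ` B)"
    using linear_independent_injective_image[OF assms(1) B(1)] inj_on_subset[OF \<open>inj F\<close>] by blast
  then have "card (F ` B) \<le> DIM('b)" using independent_bound by blast
  moreover have "card (F ` B) = card B" using \<open>inj F\<close> by (simp add: card_image inj_on_subset)
  ultimately show False using assms(2) B(2) by simp
qed

text \<open>
  In \<open>\<complex>\<^sup>2\<close> there are no three nonzero vectors that are pairwise orthogonal for the Hermitian
  product: the orthogonal complement of \<open>(a, b)\<close> is a complex line, so the other two vectors are
  proportional as well as orthogonal.
\<close>

lemma hermitian_orthogonal_triple:
  fixes a b c d e f :: complex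
  assumes uv: "cnj a * c + cnj b * d = 0" and uw: "cnj a * e + cnj b * f = 0"
    and vw: "cnj c * e + cnj d * f = 0"
    and u: "(a, b) \<noteq> (0, 0)" and v: "(c, d) \<noteq> (0, 0)"
  shows "(e, f) = (0, 0)"
proof -
  have "cnj a * (c * f - d * e) = 0" "cnj b * (c * f - d * e) = 0" using uv uw by algebra+
  then have cf: "c * f = d * e" using u by auto
  have "(cnj c * c + cnj d * d) * f = 0" "(cnj c * c + cnj d * d) * e = 0"
    using cf vw by algebra+
  moreover have "cnj c * c + cnj d * d \<noteq> 0"
  proof
    assume "cnj c * c + cnj d * d = 0"
    then have "of_real ((cmod c)\<^sup>2 + (cmod d)\<^sup>2) = (0 :: complex)"
      by (simp add: complex_norm_square mult.commute del: of_real_power)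
    then have "(cmod c)\<^sup>2 + (cmod d)\<^sup>2 = 0" by (simp only: of_real_eq_0_iff)
    then show False using v by (simp add: sum_power2_eq_zero_iff)
  qed
  ultimately show ?thesis by simp
qed

text \<open>
  The four expressions are the components of the quaternion product of \<open>v\<close> with the conjugate of
  \<open>u\<close>, and the sum of their squares is \<open>|u|\<^sup>2 |v|\<^sup>2\<close> (Euler's
  four-square identity).
\<close>

lemma self_dual_triple_no_isotropic_plane:
  fixes u1 u2 u3 u4 v1 v2 v3 v4 :: real
  assumes "u1 * v2 - u2 * v1 + (u3 * v4 - u4 * v3) = 0"
    and "u1 * v3 - u3 * v1 + (u4 * v2 - u2 * v4) = 0"
    and "u1 * v4 - u4 * v1 + (u2 * v3 - u3 * v2) = 0"
    and "u1 * v1 + u2 * v2 + u3 * v3 + u4 * v4 = 0"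
  shows "u1 = 0 \<and> u2 = 0 \<and> u3 = 0 \<and> u4 = 0 \<or> v1 = 0 \<and> v2 = 0 \<and> v3 = 0 \<and> v4 = 0"
proof -
  have "(u1\<^sup>2 + u2\<^sup>2 + u3\<^sup>2 + u4\<^sup>2) * (v1\<^sup>2 + v2\<^sup>2 + v3\<^sup>2 + v4\<^sup>2) = 0"
    using assms by algebra
  then have "u1\<^sup>2 + u2\<^sup>2 + u3\<^sup>2 + u4\<^sup>2 = 0 \<or> v1\<^sup>2 + v2\<^sup>2 + v3\<^sup>2 + v4\<^sup>2 = 0" by simp
  then show ?thesis by (simp add: add_nonneg_eq_0_iff)
qed

text \<open>
  The vectors \<open>x\<close> and \<open>y\<close> span a plane in \<open>W \<inter> ker f\<^sup>5\<close>. A third vector \<open>z\<close> of \<open>W\<close> is taken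
  orthogonal to both in the first four coordinates; each of these choices meets at most four linear
  conditions in dimension 5. If \<open>f\<^sup>5(z) \<noteq> 0\<close>, contraction with \<open>z\<close> shows that \<open>\<omega>2\<close> and \<open>\<omega>3\<close> vanish on
  the plane, which the quaternionic identity forbids. If \<open>f\<^sup>5(z) = 0\<close>, then \<open>\<omega>1\<close> and the inner
  product, which are the imaginary and real parts of the standard Hermitian product of \<open>\<complex>\<^sup>2\<close>, make
  \<open>x, y, z\<close> pairwise orthogonal.
\<close>

lemma no_hypo_restriction:
  fixes f1 f2 f3 f4 f5 :: "'g::real_vector form"
  assumes dim: "dim (UNIV :: 'g set) = 5"
    and f: "span {f1, f2, f3, f4, f5} = alt_forms 1"
    and vw: "v \<in> alt_forms 1" "w \<in> alt_forms 1"
    and W: "W = {x. v [x] = 0 \<and> w [x] = 0}"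
    and \<omega>1: "f1 \<and>\<^sub>f f2 + f3 \<and>\<^sub>f f4 \<in> vanishing_on W"
    and \<omega>2: "(f1 \<and>\<^sub>f f3 + f4 \<and>\<^sub>f f2) \<and>\<^sub>f f5 \<in> vanishing_on W"
    and \<omega>3: "(f1 \<and>\<^sub>f f4 + f2 \<and>\<^sub>f f3) \<and>\<^sub>f f5 \<in> vanishing_on W"
  shows False
proof -
  have fi: "f1 \<in> alt_forms 1" "f2 \<in> alt_forms 1" "f3 \<in> alt_forms 1"
      "f4 \<in> alt_forms 1" "f5 \<in> alt_forms 1"
    unfolding f[symmetric] by (simp_all add: span_base)
  note lin = fi[THEN alt_forms_one_linear] vw[THEN alt_forms_one_linear]
  have zero: "x = 0" if "f1 [x] = 0" "f2 [x] = 0" "f3 [x] = 0" "f4 [x] = 0" "f5 [x] = 0" for x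
  proof (rule one_forms_separate_points)
    fix \<gamma> :: "'g form" assume "\<gamma> \<in> alt_forms 1"
    moreover have "{\<gamma>. \<gamma> [x] = (0 :: real)} \<supseteq> span {f1, f2, f3, f4, f5}"
    proof (rule span_minimal)
      show "{f1, f2, f3, f4, f5} \<subseteq> {\<gamma>. \<gamma> [x] = (0 :: real)}" using that by simp
      show "subspace {\<gamma> :: 'g form. \<gamma> [x] = 0}" by (simp add: subspace_def scaleR_fun_def)
    qed
    ultimately show "\<gamma> [x] = 0" using f by blast
  qed
  have q1: "f1 [x] * f2 [y] - f2 [x] * f1 [y] + (f3 [x] * f4 [y] - f4 [x] * f3 [y]) = 0"
    if "x \<in> W" "y \<in> W" for x y
  proof -
    have "(f1 \<and>\<^sub>f f2 + f3 \<and>\<^sub>f f4) [x, y] = 0" using \<omega>1 that by (simp add: vanishing_on_def)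
    then show ?thesis using fi by (simp add: wedge_one_one algebra_simps)
  qed
  have q2: "f1 [x] * f3 [y] - f3 [x] * f1 [y] + (f4 [x] * f2 [y] - f2 [x] * f4 [y]) = 0"
    and q3: "f1 [x] * f4 [y] - f4 [x] * f1 [y] + (f2 [x] * f3 [y] - f3 [x] * f2 [y]) = 0"
    if "x \<in> W" "y \<in> W" "z \<in> W" "f5 [x] = 0" "f5 [y] = 0" "f5 [z] \<noteq> 0" for x y z
  proof -
    have "((f1 \<and>\<^sub>f f3 + f4 \<and>\<^sub>f f2) \<and>\<^sub>f f5) [x, y, z]
        = f5 [z] * (f1 [x] * f3 [y] - f3 [x] * f1 [y] + (f4 [x] * f2 [y] - f2 [x] * f4 [y]))"
      using fi that by (simp add: wedge_add_left wedge_three det3_def algebra_simps)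
    moreover have "((f1 \<and>\<^sub>f f3 + f4 \<and>\<^sub>f f2) \<and>\<^sub>f f5) [x, y, z] = 0"
      using \<omega>2 that by (simp add: vanishing_on_def)
    ultimately show "f1 [x] * f3 [y] - f3 [x] * f1 [y] + (f4 [x] * f2 [y] - f2 [x] * f4 [y]) = 0"
      using that(6) by simp
    have "((f1 \<and>\<^sub>f f4 + f2 \<and>\<^sub>f f3) \<and>\<^sub>f f5) [x, y, z]
        = f5 [z] * (f1 [x] * f4 [y] - f4 [x] * f1 [y] + (f2 [x] * f3 [y] - f3 [x] * f2 [y]))"
      using fi that by (simp add: wedge_add_left wedge_three det3_def algebra_simps)
    moreover have "((f1 \<and>\<^sub>f f4 + f2 \<and>\<^sub>f f3) \<and>\<^sub>f f5) [x, y, z] = 0"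
      using \<omega>3 that by (simp add: vanishing_on_def)
    ultimately show "f1 [x] * f4 [y] - f4 [x] * f1 [y] + (f2 [x] * f3 [y] - f3 [x] * f2 [y]) = 0"
      using that(6) by simp
  qed
  define ip where "ip x y = f1 [x] * f1 [y] + f2 [x] * f2 [y] + f3 [x] * f3 [y] + f4 [x] * f4 [y]"
    for x y
  have ip: "linear (ip x)" for x
    by (rule linearI)
      (simp_all add: ip_def lin[THEN linear_add] lin[THEN linear_scale] algebra_simps)
  have nonzero: "f1 [x] \<noteq> 0 \<or> f2 [x] \<noteq> 0 \<or> f3 [x] \<noteq> 0 \<or> f4 [x] \<noteq> 0"
    if "x \<noteq> 0" "f5 [x] = 0" for x
    using zero that by blast
  have ex: "\<exists>x. x \<noteq> 0 \<and> a x = 0 \<and> b x = 0 \<and> c x = 0 \<and> d x = 0"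
    if "linear a" "linear b" "linear c" "linear d" for a b c d :: "'g \<Rightarrow> real"
  proof -
    have "linear (\<lambda>x. (a x, b x, c x, d x))"
      by (rule linearI) (simp_all add: that[THEN linear_add] that[THEN linear_scale])
    from ex_common_zero[OF this] dim show ?thesis by (auto simp: zero_prod_def)
  qed
  \<comment> \<open>Three conditions suffice here, so the last one is repeated to fill the quadruple.\<close>
  obtain x where x: "x \<noteq> 0" "x \<in> W" "f5 [x] = 0"
    using ex[OF lin(6) lin(7) lin(5) lin(5)] W by auto
  obtain y where y: "y \<noteq> 0" "y \<in> W" "f5 [y] = 0" "ip x y = 0"
    using ex[OF lin(6) lin(7) lin(5) ip[of x]] W by auto
  obtain z where z: "z \<noteq> 0" "z \<in> W" "ip x z = 0" "ip y z = 0"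
    using ex[OF lin(6) lin(7) ip[of x] ip[of y]] W by auto
  show False
  proof (cases "f5 [z] = 0")
    case True
    define A where "A x = Complex (f1 [x]) (f2 [x])" for x
    define B where "B x = Complex (f3 [x]) (f4 [x])" for x
    have herm: "cnj (A x) * A y + cnj (B x) * B y = 0" if "x \<in> W" "y \<in> W" "ip x y = 0" for x y
      using q1[OF that(1,2)] that(3)
      by (simp add: A_def B_def ip_def complex_eq_iff algebra_simps)
    have nz: "(A x, B x) \<noteq> (0, 0)" if "x \<noteq> 0" "f5 [x] = 0" for x
      using nonzero[OF that] by (auto simp: A_def B_def complex_eq_iff)
    show False
      using hermitian_orthogonal_triple[OF herm herm herm nz nz, of x y z] nz[of z] x y z True
      by blast
  next
    case False
    show False
      using self_dual_triple_no_isotropic_plane[OF q1[OF x(2) y(2)] q2[OF x(2) y(2) z(2) x(3) y(3) False]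
        q3[OF x(2) y(2) z(2) x(3) y(3) False] y(4)[unfolded ip_def]]
        nonzero[OF x(1,3)] nonzero[OF y(1,3)] by blast
  qed
qed

section \<open>Nonexistence of hypo structures\<close>

theorem proposition6:
  fixes br :: "'g::real_vector \<Rightarrow> 'g \<Rightarrow> 'g"
  assumes "real_lie_algebra br"
    and "dim (UNIV :: 'g set) = 5"
    and "\<exists>V1 V2. coherent_splitting br V1 V2 \<and> dim V1 = 2 \<and>
           hodge_number br V1 V2 0 3 = 0 \<and> hodge_number br V1 V2 0 2 = 0"
  shows "\<not> (\<exists>\<alpha> \<omega>1 \<omega>2 \<omega>3. hypo_structure br \<alpha> \<omega>1 \<omega>2 \<omega>3)"
proof
  assume "\<exists>\<alpha> \<omega>1 \<omega>2 \<omega>3. hypo_structure br \<alpha> \<omega>1 \<omega>2 \<omega>3"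
  then obtain \<alpha> \<omega>1 \<omega>2 \<omega>3 where hypo: "hypo_structure br \<alpha> \<omega>1 \<omega>2 \<omega>3"
    by (elim exE)
  from hypo obtain f :: "nat \<Rightarrow> 'g form" where f: "span (f ` {1..5}) = alt_forms 1" and coframe: "\<alpha> = f 5"
    "\<omega>1 = f 1 \<and>\<^sub>f f 2 + f 3 \<and>\<^sub>f f 4" "\<omega>2 = f 1 \<and>\<^sub>f f 3 + f 4 \<and>\<^sub>f f 2"
    "\<omega>3 = f 1 \<and>\<^sub>f f 4 + f 2 \<and>\<^sub>f f 3"
    unfolding hypo_structure_def by (elim conjE exE) (rule that; assumption)
  have "ce_diff br \<omega>1 = 0" "ce_diff br (\<omega>2 \<and>\<^sub>f \<alpha>) = 0" "ce_diff br (\<omega>3 \<and>\<^sub>f \<alpha>) = 0"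
    using hypo by (simp_all only: hypo_structure_def simp_thms)
  note d = this[unfolded coframe]
  obtain V1 V2 where V: "coherent_splitting br V1 V2" and "dim V1 = 2"
    and h3: "hodge_number br V1 V2 0 3 = 0" and h2: "hodge_number br V1 V2 0 2 = 0"
    using assms(3) by blast
  have dim: "dim (UNIV :: 'g set) > 0" using assms(2) by simp
  have sum: "V1 + V2 = alt_forms 1" and sub: "subspace V1" "subspace V2"
    using V by (auto simp: coherent_splitting_def)
  have V1: "V1 \<subseteq> alt_forms 1"
    using set_plus_intro[of _ V1 0 V2] subspace_0[OF sub(2)] sum by fastforce
  have V2: "V2 \<subseteq> alt_forms 1"
    using set_plus_intro[of 0 V1 _ V2] subspace_0[OF sub(1)] sum by fastforce
  obtain B where B: "B \<subseteq> V1" "V1 \<subseteq> span B" "card B = 2"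
    using basis_exists[of V1] \<open>dim V1 = 2\<close> by metis
  then obtain v w where vw: "B = {v, w}" by (auto simp: card_2_iff)
  define W where "W = {x. v [x] = 0 \<and> w [x] = 0}"
  have vw1: "v \<in> alt_forms 1" "w \<in> alt_forms 1" using B(1) vw V1 by auto
  have "u \<in> vanishing_on W" if "u \<in> {v, w}" for u
    unfolding vanishing_on_def
  proof (intro CollectI allI impI)
    fix xs assume "set xs \<subseteq> W"
    have u: "u \<in> alt_forms 1" using that vw1 by auto
    show "u xs = 0"
    proof (cases "length xs = 1")
      case True
      then obtain x where "xs = [x]" by (auto simp: length_Suc_conv)
      then show ?thesis using that \<open>set xs \<subseteq> W\<close> by (auto simp: W_def)
    qed (rule alt_forms_other_length[OF u])
  qed
  then have "span {v, w} \<subseteq> vanishing_on W"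
    by (intro span_minimal subspace_vanishing_on) blast
  then have W: "V1 \<subseteq> vanishing_on W" using B(2) vw by simp
  have f1: "f i \<in> alt_forms 1" if "i \<in> {1..5}" for i
    using span_base[OF imageI[OF that, of f]] unfolding f .
  then have fi: "f 1 \<in> alt_forms 1" "f 2 \<in> alt_forms 1" "f 3 \<in> alt_forms 1"
      "f 4 \<in> alt_forms 1" "f 5 \<in> alt_forms 1" by auto
  have S: "subspace (\<Sum>s = 0..dim V1. bidegree V1 V2 (int s) (int k - int s))" for k
    by (rule subspace_sum_sets) (auto simp: bidegree_def subspace_span)
  note two = wedge_two_in_filtration[OF sum V1 V2 \<open>dim V1 = 2\<close>]
  note three = wedge_three_in_filtration[OF sum V1 V2 \<open>dim V1 = 2\<close>]
  have r1: "f 1 \<and>\<^sub>f f 2 + f 3 \<and>\<^sub>f f 4 \<in> vanishing_on W"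
  proof (rule closed_form_vanishing_on[OF dim V W h2])
    show "f 1 \<and>\<^sub>f f 2 + f 3 \<and>\<^sub>f f 4 \<in> closed_forms br 2"
      unfolding closed_forms_def using d(1) fi
      by (simp add: subspace_add[OF subspace_alt_forms] wedge_one_one_alt)
    show "f 1 \<and>\<^sub>f f 2 + f 3 \<and>\<^sub>f f 4 \<in> (\<Sum>s = 0..dim V1. bidegree V1 V2 (int s) (int 2 - int s))"
      by (intro subspace_add[OF S] two fi)
  qed
  have r23: "(f i \<and>\<^sub>f f j + f k \<and>\<^sub>f f l) \<and>\<^sub>f f 5 \<in> vanishing_on W"
    if di: "ce_diff br ((f i \<and>\<^sub>f f j + f k \<and>\<^sub>f f l) \<and>\<^sub>f f 5) = 0" and "{i, j, k, l} \<subseteq> {1..5}"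
    for i j k l
  proof (rule closed_form_vanishing_on[OF dim V W h3])
    have fij: "f i \<in> alt_forms 1" "f j \<in> alt_forms 1" "f k \<in> alt_forms 1" "f l \<in> alt_forms 1"
      using f1 that(2) by auto
    show "(f i \<and>\<^sub>f f j + f k \<and>\<^sub>f f l) \<and>\<^sub>f f 5 \<in> closed_forms br 3"
      unfolding closed_forms_def
      using di subspace_add[OF subspace_alt_forms wedge_three_alt wedge_three_alt] fij fi(5)
      by (simp add: wedge_add_left)
    show "(f i \<and>\<^sub>f f j + f k \<and>\<^sub>f f l) \<and>\<^sub>f f 5
        \<in> (\<Sum>s = 0..dim V1. bidegree V1 V2 (int s) (int 3 - int s))"
      unfolding wedge_add_left by (intro subspace_add[OF S] three fij fi)
  qed
  have "{1..5 :: nat} = {1, 2, 3, 4, 5}" by auto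
  then have span: "span {f 1, f 2, f 3, f 4, f 5} = alt_forms 1"
    using f by (simp only: image_insert image_empty)
  show False
    by (rule no_hypo_restriction[OF assms(2) span vw1 W_def r1 r23[OF d(2)] r23[OF d(3)]]) simp_all
qed

end
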